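(* Let $\mathcal{P}=\{p_1<\cdots<p_{l-1}\}$ be a finite nonempty set of primes and $\beta_{\mathcal{P}}=\min\{1/3,1/p_{l-1}\}$. Let $U\subset X_{\mathcal{P}}$ be open, let $S\subset X_{\mathcal{P}}$ be any cylinder absolute winning subset, and let $\Psi:X_{\mathcal{P}}\to X_{\mathcal{P}}$ be an invertible affine homomorphism. Then the set $\Psi^{-1}S\cup(X_{\mathcal{P}}\setminus U)$ is also cylinder absolute winning, with winning dimension at least $\beta_{\mathcal{P}}$.
   Context: Setting. $X_{\mathcal{P}}=\mathbb{R}\times\prod_{p\in\mathcal{P}}\mathbb{Q}_p$, with elements $\mathbf{x}=(x_0,x_1,\dots,x_{l-1})$, $x_0\in\mathbb{R}$, $x_i\in\mathbb{Q}_{p_i}$, and metric $d(\mathbf{x},\mathbf{z})=\max\{|x_0-z_0|,\ \sup_{i\ge1}p_i^{-1}|x_i-z_i|_{p_i}\}$, with $|\cdot|_p$ the usual $p$-adic absolute value ($|p|_p=1/p$). $\overline{B}(\mathbf{x},r)=\{\mathbf{z}: d(\mathbf{x},\mathbf{z})\le r\}$ is the closed ball of radius $r>0$. An invertible affine homomorphism of $X_{\mathcal{P}}$ is a map $\Psi(\mathbf{x})=D\mathbf{x}+\mathbf{a}$ with $D$ a non-zero rational number acting by multiplication in every coordinate and $\mathbf{a}\in X_{\mathcal{P}}$. Cylinders. For $\mathbf{x}\in X_{\mathcal{P}}$, $\varepsilon>0$, the open cylinder $C(\mathbf{x},\varepsilon,i)$ with constraining coordinate $i$ is $\{\mathbf{z}:|z_0-x_0|<\varepsilon\}$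 if $i=0$ and $\{\mathbf{z}:|z_i-x_i|_{p_i}<p_i\varepsilon\}$ if $i>0$. Its radius is $\varepsilon$ if $i=0$, and the infimum of all $\varepsilon'>0$ with $C(\mathbf{x},\varepsilon',i)=C(\mathbf{x},\varepsilon,i)$ if $i>0$. Game. Let $F\subset X_{\mathcal{P}}$ and $0<\beta<1$. In the cylinder $\beta$-absolute game Bob first chooses a closed ball $B_0$. For $j\ge1$, given $B_{j-1}$, Alice chooses an open cylinder $C_j$ of radius at most $\beta\cdot\mathrm{radius}(B_{j-1})$, and then Bob chooses a closed ball $B_j\subset B_{j-1}\setminus C_j$ with $\mathrm{radius}(B_j)\ge\beta\cdot\mathrm{radius}(B_{j-1})$. If at some finite stage Bob has no legal choice, Bob wins; otherwise Alice wins iff $\bigcap_j B_j\cap F\ne\emptyset$. $F$ is cylinder $\beta$-absolute winning if Alice has a winning strategy. $F$ is cylinder absolute winning (CAW) if there is $0<\beta_1\le1/3$ such that $F$ is cylinder $\beta$-absolute winning for all $\beta\in(0,\beta_1)$; the supremum of such $\beta_1$ is the winning dimension (CAW dimension) of $F$. *)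

theory Defs
  imports "HOL-Analysis.Analysis" "HOL-Algebra.QuotRing"
begin

section \<open>The field of \<open>p\<close>-adic numbers\<close>

definition padic_abs :: "nat \<Rightarrow> rat \<Rightarrow> real" where
  "padic_abs p q =
     (if q = 0 then 0
      else real p powi (int (multiplicity (int p) (snd (quotient_of q)))
                        - int (multiplicity (int p) (fst (quotient_of q)))))"

lemma padic_abs_frac:
  assumes p: "prime p" and ab: "a \<noteq> 0" "b \<noteq> 0"
  shows "padic_abs p (of_int a / of_int b) =
    real p powi (int (multiplicity (int p) b) - int (multiplicity (int p) a))"
proof -
  obtain n d where nd: "quotient_of (of_int a / of_int b) = (n, d)" by fastforce
  have d: "d > 0" using quotient_of_denom_pos[OF nd] .
  have eq: "(of_int a / of_int b :: rat) = of_int n / of_int d" using quotient_of_div[OF nd] .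
  hence "(of_int (a * d) :: rat) = of_int (n * b)" using ab d by (simp add: field_simps)
  hence e: "a * d = n * b" using of_int_eq_iff by blast
  have n0: "n \<noteq> 0" using e ab d by auto
  have pp: "prime_elem (int p)" using p by (simp add: prime_imp_prime_elem)
  have "multiplicity (int p) a + multiplicity (int p) d = multiplicity (int p) n + multiplicity (int p) b"
    using e n0 ab d prime_elem_multiplicity_mult_distrib[OF pp] by (metis less_int_code(1))
  hence "int (multiplicity (int p) d) - int (multiplicity (int p) n) =
      int (multiplicity (int p) b) - int (multiplicity (int p) a)" by linarith
  thus ?thesis using nd ab by (simp add: padic_abs_def)
qed

lemma rat_frac_cases:
  obtains a b where "b \<noteq> 0" "(q::rat) = of_int a / of_int b"
  by (metis quotient_of_denom_pos' quotient_of_div less_irrefl surjective_pairing)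

lemma padic_abs_nonneg [simp]: "padic_abs p q \<ge> 0"
  by (simp add: padic_abs_def)

lemma padic_abs_zero [simp]: "padic_abs p 0 = 0"
  by (simp add: padic_abs_def)

lemma padic_abs_eq_0_iff: "prime p \<Longrightarrow> padic_abs p q = 0 \<longleftrightarrow> q = 0"
  by (auto simp: padic_abs_def prime_gt_0_nat)

lemma padic_abs_mult:
  assumes p: "prime p"
  shows "padic_abs p (x * y) = padic_abs p x * padic_abs p y"
proof (cases "x = 0 \<or> y = 0")
  case False
  obtain a b where ab: "b \<noteq> 0" "x = of_int a / of_int b" by (rule rat_frac_cases)
  obtain c d where cd: "d \<noteq> 0" "y = of_int c / of_int d" by (rule rat_frac_cases)
  have nz: "a \<noteq> 0" "c \<noteq> 0" using False ab cd by auto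
  have pp: "prime_elem (int p)" using p by (simp add: prime_imp_prime_elem)
  have p0: "real p \<noteq> 0" using p prime_gt_0_nat by auto
  have xy: "x * y = of_int (a * c) / of_int (b * d)" by (simp add: ab cd)
  have "padic_abs p (x * y) = real p powi
      (int (multiplicity (int p) (b * d)) - int (multiplicity (int p) (a * c)))"
    unfolding xy by (rule padic_abs_frac[OF p]) (use ab cd nz in auto)
  also have "\<dots> = padic_abs p x * padic_abs p y"
    unfolding ab(2) cd(2) padic_abs_frac[OF p nz(1) ab(1)] padic_abs_frac[OF p nz(2) cd(1)]
    using p0 nz ab(1) cd(1)
    by (simp add: prime_elem_multiplicity_mult_distrib[OF pp] power_int_diff power_int_add power_add)
  finally show ?thesis .
qed auto

lemma padic_abs_minus [simp]:
  assumes p: "prime p" shows "padic_abs p (- x) = padic_abs p x"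
proof (cases "x = 0")
  case False
  obtain a b where ab: "b \<noteq> 0" "x = of_int a / of_int b" by (rule rat_frac_cases)
  have m: "- x = of_int (- a) / of_int b" by (simp add: ab)
  have m1: "multiplicity (int p) (- a) = multiplicity (int p) a"
    by (metis multiplicity_normalize_right normalize_int_def abs_minus_cancel)
  show ?thesis
    using False ab padic_abs_frac[OF p, of "- a" b] padic_abs_frac[OF p, of a b] m by (simp add: m1)
qed simp

lemma padic_abs_ultrametric:
  assumes p: "prime p"
  shows "padic_abs p (x + y) \<le> max (padic_abs p x) (padic_abs p y)"
proof (cases "x = 0 \<or> y = 0 \<or> x + y = 0")
  case False
  obtain a b where ab: "b \<noteq> 0" "x = of_int a / of_int b" by (rule rat_frac_cases)
  obtain c d where cd: "d \<noteq> 0" "y = of_int c / of_int d" by (rule rat_frac_cases)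
  define e where "e = b * d"
  define u where "u = a * d"
  define v where "v = c * b"
  have e: "e \<noteq> 0" and x: "x = of_int u / of_int e" and y: "y = of_int v / of_int e"
    using ab cd by (auto simp: e_def u_def v_def)
  have xy: "x + y = of_int (u + v) / of_int e" using x y by (simp add: add_divide_distrib)
  have nz: "u \<noteq> 0" "v \<noteq> 0" "u + v \<noteq> 0" using False x y xy by auto
  let ?m = "multiplicity (int p)"
  have nu: "\<not> is_unit (int p)" using p prime_gt_1_nat[OF p] by auto
  have "int p ^ min (?m u) (?m v) dvd u + v"
    by (intro dvd_add multiplicity_dvd') auto
  hence le: "min (?m u) (?m v) \<le> ?m (u + v)"
    by (rule multiplicity_geI[OF nz(3) nu])
  have "real p powi (int (?m e) - int (?m (u + v))) \<le>
      real p powi (int (?m e) - int (min (?m u) (?m v)))"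
    using le prime_gt_1_nat[OF p] by (intro power_int_increasing) auto
  also have "\<dots> \<le> max (real p powi (int (?m e) - int (?m u))) (real p powi (int (?m e) - int (?m v)))"
    by (cases "?m u \<le> ?m v") (auto simp: min_def)
  finally show ?thesis
    using x y xy by (simp only: padic_abs_frac[OF p nz(1) e] padic_abs_frac[OF p nz(2) e]
       padic_abs_frac[OF p nz(3) e])
qed (use p in \<open>auto simp: max_def\<close>)

lemma padic_abs_triangle: "prime p \<Longrightarrow> padic_abs p (x + y) \<le> padic_abs p x + padic_abs p y"
  by (smt (verit) padic_abs_ultrametric padic_abs_nonneg)

lemma padic_abs_diff_comm: "prime p \<Longrightarrow> padic_abs p (x - y) = padic_abs p (y - x)"
  by (metis padic_abs_minus minus_diff_eq)

lemma Metric_space_padic_abs: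
  assumes p: "prime p" shows "Metric_space UNIV (\<lambda>x y. padic_abs p (x - y))"
proof
  show "padic_abs p (x - z) \<le> padic_abs p (x - y) + padic_abs p (y - z)" for x y z
    using padic_abs_triangle[OF p, of "x - y" "y - z"] by simp
qed (auto simp: padic_abs_diff_comm[OF p] padic_abs_eq_0_iff[OF p])

text \<open>For a prime \<open>p\<close>, \<open>\<rat>\<^sub>p\<close> is the completion of \<open>\<rat>\<close> with respect to \<^const>\<open>padic_abs\<close>: the ring of
  rational Cauchy sequences modulo the ideal of null sequences.  Since its elements are cosets,
  all the fields \<open>\<rat>\<^sub>p\<close> live in one HOL type.\<close>

definition padic_Cauchy_ring :: "nat \<Rightarrow> (nat \<Rightarrow> rat) ring" where
  "padic_Cauchy_ring p =
     \<lparr>carrier = {X. Metric_space.MCauchy UNIV (\<lambda>x y. padic_abs p (x - y)) X},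
      mult = (\<lambda>X Y n. X n * Y n), one = (\<lambda>_. 1), zero = (\<lambda>_. 0), add = (\<lambda>X Y n. X n + Y n)\<rparr>"

definition padic_null_ideal :: "nat \<Rightarrow> (nat \<Rightarrow> rat) set" where
  "padic_null_ideal p =
     {X \<in> carrier (padic_Cauchy_ring p). (\<lambda>n. padic_abs p (X n)) \<longlonglongrightarrow> 0}"

type_synonym padic = "(nat \<Rightarrow> rat) set"

definition padic_field :: "nat \<Rightarrow> padic ring" where
  "padic_field p = padic_Cauchy_ring p Quot padic_null_ideal p"

definition padic_of_rat :: "nat \<Rightarrow> rat \<Rightarrow> padic" where
  "padic_of_rat p q = padic_null_ideal p +>\<^bsub>padic_Cauchy_ring p\<^esub> (\<lambda>_. q)"

definition padic_norm :: "nat \<Rightarrow> padic \<Rightarrow> real" where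
  "padic_norm p x = (THE c. \<forall>X\<in>x. (\<lambda>n. padic_abs p (X n)) \<longlonglongrightarrow> c)"

lemma padic_Cauchy_ring_carrier:
  assumes "prime p"
  shows "X \<in> carrier (padic_Cauchy_ring p) \<longleftrightarrow>
    (\<forall>e>0. \<exists>N. \<forall>n m. N \<le> n \<longrightarrow> N \<le> m \<longrightarrow> padic_abs p (X n - X m) < e)"
  by (simp add: padic_Cauchy_ring_def Metric_space.MCauchy_def[OF Metric_space_padic_abs[OF assms]])

lemma padic_Cauchy_bounded:
  assumes p: "prime p" and X: "X \<in> carrier (padic_Cauchy_ring p)"
  shows "\<exists>K>0. \<forall>n. padic_abs p (X n) \<le> K"
proof -
  obtain N where N: "\<And>n m. N \<le> n \<Longrightarrow> N \<le> m \<Longrightarrow> padic_abs p (X n - X m) < 1"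
    using X padic_Cauchy_ring_carrier[OF p] by (metis zero_less_one)
  define K where "K = (\<Sum>n\<le>N. padic_abs p (X n)) + 1"
  have K: "padic_abs p (X n) \<le> K - 1" if "n \<le> N" for n
    unfolding K_def using that member_le_sum[of n "{..N}" "\<lambda>n. padic_abs p (X n)"] by simp
  have "padic_abs p (X n) \<le> K" for n
  proof (cases "n \<le> N")
    case False
    have "padic_abs p (X n) \<le> padic_abs p (X n - X N) + padic_abs p (X N)"
      using padic_abs_triangle[OF p, of "X n - X N" "X N"] by simp
    thus ?thesis using K[of N] N[of n N] False by auto
  qed (use K in force)
  moreover have "K > 0" using K[of 0] padic_abs_nonneg[of p "X 0"] by linarith
  ultimately show ?thesis by blast
qed

lemma cring_padic_Cauchy_ring:
  assumes p: "prime p" shows "cring (padic_Cauchy_ring p)"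
proof -
  let ?R = "padic_Cauchy_ring p"
  note C = padic_Cauchy_ring_carrier[OF p]
  have add: "(\<lambda>n. X n + Y n) \<in> carrier ?R" if XY: "X \<in> carrier ?R" "Y \<in> carrier ?R" for X Y
    unfolding C
  proof (intro allI impI)
    fix e :: real assume e: "e > 0"
    obtain N M where N: "\<And>n m. N \<le> n \<Longrightarrow> N \<le> m \<Longrightarrow> padic_abs p (X n - X m) < e"
      and M: "\<And>n m. M \<le> n \<Longrightarrow> M \<le> m \<Longrightarrow> padic_abs p (Y n - Y m) < e"
      using XY e C by meson
    have "padic_abs p (X n + Y n - (X m + Y m)) < e" if "max N M \<le> n" "max N M \<le> m" for n m
      using padic_abs_ultrametric[OF p, of "X n - X m" "Y n - Y m"] N[of n m] M[of n m] that
      by (simp add: algebra_simps)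
    thus "\<exists>N. \<forall>n m. N \<le> n \<longrightarrow> N \<le> m \<longrightarrow> padic_abs p (X n + Y n - (X m + Y m)) < e" by blast
  qed
  have mult: "(\<lambda>n. X n * Y n) \<in> carrier ?R" if XY: "X \<in> carrier ?R" "Y \<in> carrier ?R" for X Y
    unfolding C
  proof (intro allI impI)
    fix e :: real assume e: "e > 0"
    obtain K where K: "K > 0" "\<And>n. padic_abs p (X n) \<le> K" using padic_Cauchy_bounded[OF p XY(1)] by blast
    obtain L where L: "L > 0" "\<And>n. padic_abs p (Y n) \<le> L" using padic_Cauchy_bounded[OF p XY(2)] by blast
    obtain N M where N: "\<And>n m. N \<le> n \<Longrightarrow> N \<le> m \<Longrightarrow> padic_abs p (X n - X m) < e / L"
      and M: "\<And>n m. M \<le> n \<Longrightarrow> M \<le> m \<Longrightarrow> padic_abs p (Y n - Y m) < e / K"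
      using XY e C K L by (meson divide_pos_pos)
    have "padic_abs p (X n * Y n - X m * Y m) < e" if "max N M \<le> n" "max N M \<le> m" for n m
    proof -
      have "X n * Y n - X m * Y m = X n * (Y n - Y m) + (X n - X m) * Y m" by (simp add: algebra_simps)
      hence "padic_abs p (X n * Y n - X m * Y m)
          \<le> max (padic_abs p (X n) * padic_abs p (Y n - Y m)) (padic_abs p (X n - X m) * padic_abs p (Y m))"
        using padic_abs_ultrametric[OF p, of "X n * (Y n - Y m)" "(X n - X m) * Y m"]
        by (simp add: padic_abs_mult[OF p])
      moreover have "padic_abs p (X n) * padic_abs p (Y n - Y m) \<le> K * padic_abs p (Y n - Y m)"
        using K by (intro mult_right_mono) auto
      moreover have "K * padic_abs p (Y n - Y m) < e"
        using M[of n m] that K by (simp add: field_simps)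
      moreover have "padic_abs p (X n - X m) * padic_abs p (Y m) \<le> padic_abs p (X n - X m) * L"
        using L by (intro mult_left_mono) auto
      moreover have "padic_abs p (X n - X m) * L < e"
        using N[of n m] that L by (simp add: field_simps)
      ultimately show ?thesis by linarith
    qed
    thus "\<exists>N. \<forall>n m. N \<le> n \<longrightarrow> N \<le> m \<longrightarrow> padic_abs p (X n * Y n - X m * Y m) < e" by blast
  qed
  have const: "(\<lambda>_. q) \<in> carrier ?R" for q by (simp add: C)
  have uminus: "(\<lambda>n. - X n) \<in> carrier ?R" if "X \<in> carrier ?R" for X
    using mult[OF const[of "-1"] that] by simp
  have ops: "X \<otimes>\<^bsub>?R\<^esub> Y = (\<lambda>n. X n * Y n)" "X \<oplus>\<^bsub>?R\<^esub> Y = (\<lambda>n. X n + Y n)"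
    "\<one>\<^bsub>?R\<^esub> = (\<lambda>_. 1)" "\<zero>\<^bsub>?R\<^esub> = (\<lambda>_. 0)" for X Y
    by (simp_all add: padic_Cauchy_ring_def)
  show ?thesis
  proof (intro cringI abelian_groupI comm_monoidI)
    fix X assume X: "X \<in> carrier ?R"
    show "\<exists>Y\<in>carrier ?R. Y \<oplus>\<^bsub>?R\<^esub> X = \<zero>\<^bsub>?R\<^esub>"
      by (rule bexI[OF _ uminus[OF X]]) (simp add: ops)
  qed (auto simp: ops add mult const algebra_simps)
qed

lemma padic_Cauchy_ring_minus:
  assumes p: "prime p" and XY: "X \<in> carrier (padic_Cauchy_ring p)" "Y \<in> carrier (padic_Cauchy_ring p)"
  shows "X \<ominus>\<^bsub>padic_Cauchy_ring p\<^esub> Y = (\<lambda>n. X n - Y n)"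
proof -
  let ?R = "padic_Cauchy_ring p"
  interpret cring ?R by (rule cring_padic_Cauchy_ring[OF p])
  have c: "(\<lambda>n. - Y n) \<in> carrier ?R"
    using XY(2) unfolding padic_Cauchy_ring_carrier[OF p]
    by (metis (no_types, lifting) minus_diff_minus padic_abs_minus[OF p])
  have "\<ominus>\<^bsub>?R\<^esub> Y = (\<lambda>n. - Y n)"
    by (rule minus_equality[OF _ XY(2) c]) (simp add: padic_Cauchy_ring_def)
  thus ?thesis by (simp add: a_minus_def padic_Cauchy_ring_def)
qed

lemma ideal_padic_null_ideal:
  assumes p: "prime p" shows "ideal (padic_null_ideal p) (padic_Cauchy_ring p)"
proof -
  let ?R = "padic_Cauchy_ring p" and ?I = "padic_null_ideal p"
  interpret cring ?R by (rule cring_padic_Cauchy_ring[OF p])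
  have mult: "(\<lambda>n. X n * Y n) \<in> ?I" if XY: "X \<in> carrier ?R" "Y \<in> ?I" for X Y
  proof -
    obtain K where K: "K > 0" "\<And>n. padic_abs p (X n) \<le> K" using padic_Cauchy_bounded[OF p XY(1)] by blast
    have "(\<lambda>n. K * padic_abs p (Y n)) \<longlonglongrightarrow> 0"
      using XY(2) tendsto_mult_right_zero by (fastforce simp: padic_null_ideal_def)
    hence "(\<lambda>n. padic_abs p (X n * Y n)) \<longlonglongrightarrow> 0"
      by (rule Lim_null_comparison[rotated])
        (simp add: padic_abs_mult[OF p] K(2) mult_right_mono)
    moreover have "(\<lambda>n. X n * Y n) \<in> carrier ?R"
      using m_closed[of X Y] XY by (auto simp: padic_null_ideal_def padic_Cauchy_ring_def)
    ultimately show ?thesis by (simp add: padic_null_ideal_def)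
  qed
  have add: "(\<lambda>n. X n + Y n) \<in> ?I" if "X \<in> ?I" "Y \<in> ?I" for X Y
  proof -
    have "(\<lambda>n. padic_abs p (X n) + padic_abs p (Y n)) \<longlonglongrightarrow> 0"
      using that tendsto_add[of _ 0 _ _ 0] by (fastforce simp: padic_null_ideal_def)
    hence "(\<lambda>n. padic_abs p (X n + Y n)) \<longlonglongrightarrow> 0"
      by (rule Lim_null_comparison[rotated]) (simp add: padic_abs_triangle[OF p])
    moreover have "(\<lambda>n. X n + Y n) \<in> carrier ?R"
      using a_closed[of X Y] that by (auto simp: padic_null_ideal_def padic_Cauchy_ring_def)
    ultimately show ?thesis by (simp add: padic_null_ideal_def)
  qed
  have zero: "(\<lambda>_. 0) \<in> ?I"
    by (simp add: padic_null_ideal_def padic_Cauchy_ring_carrier[OF p])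
  have const: "(\<lambda>_. q) \<in> carrier ?R" for q by (simp add: padic_Cauchy_ring_carrier[OF p])
  have uminus: "(\<lambda>n. - X n) \<in> ?I" if "X \<in> ?I" for X
    using mult[OF const[of "-1"] that] by simp
  have sub: "?I \<subseteq> carrier ?R" by (auto simp: padic_null_ideal_def)
  show ?thesis
  proof (rule idealI)
    show "subgroup ?I (add_monoid ?R)"
    proof (rule add.subgroupI)
      fix X assume X: "X \<in> ?I"
      have "\<ominus>\<^bsub>?R\<^esub> X = (\<lambda>n. - X n)"
        by (rule minus_equality) (use X sub uminus[OF X] in \<open>auto simp: padic_Cauchy_ring_def\<close>)
      thus "\<ominus>\<^bsub>?R\<^esub> X \<in> ?I" using uminus[OF X] by simp
    qed (use sub zero add in \<open>auto simp: padic_Cauchy_ring_def\<close>)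
    show "ring ?R" by (rule ring_axioms)
    fix X Y assume XY: "X \<in> ?I" "Y \<in> carrier ?R"
    have "(\<lambda>n. Y n * X n) \<in> ?I" by (rule mult[OF XY(2,1)])
    thus "Y \<otimes>\<^bsub>?R\<^esub> X \<in> ?I" "X \<otimes>\<^bsub>?R\<^esub> Y \<in> ?I"
      by (simp_all add: padic_Cauchy_ring_def mult.commute)
  qed
qed

lemma padic_field_cases:
  assumes "prime p" "x \<in> carrier (padic_field p)"
  obtains X where "X \<in> carrier (padic_Cauchy_ring p)"
    "x = padic_null_ideal p +>\<^bsub>padic_Cauchy_ring p\<^esub> X"
  using assms(2) by (auto simp: padic_field_def FactRing_def A_RCOSETS_def')

lemma cring_padic_field: "prime p \<Longrightarrow> cring (padic_field p)"
  unfolding padic_field_def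
  by (intro ideal.quotient_is_cring ideal_padic_null_ideal cring_padic_Cauchy_ring)

lemma padic_field_coset_minus:
  assumes p: "prime p" and XY: "X \<in> carrier (padic_Cauchy_ring p)" "Y \<in> carrier (padic_Cauchy_ring p)"
  shows "(padic_null_ideal p +>\<^bsub>padic_Cauchy_ring p\<^esub> X) \<ominus>\<^bsub>padic_field p\<^esub>
      (padic_null_ideal p +>\<^bsub>padic_Cauchy_ring p\<^esub> Y) =
    padic_null_ideal p +>\<^bsub>padic_Cauchy_ring p\<^esub> (\<lambda>n. X n - Y n)"
proof -
  interpret I: ideal "padic_null_ideal p" "padic_Cauchy_ring p" by (rule ideal_padic_null_ideal[OF p])
  interpret h: ring_hom_ring "padic_Cauchy_ring p" "padic_field p"
    "(+>\<^bsub>padic_Cauchy_ring p\<^esub>) (padic_null_ideal p)"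
    unfolding padic_field_def by (rule I.rcos_ring_hom_ring)
  show ?thesis
    using XY padic_Cauchy_ring_minus[OF p XY, symmetric] by (simp add: a_minus_def)
qed

lemma padic_norm_coset:
  assumes p: "prime p" and X: "X \<in> carrier (padic_Cauchy_ring p)"
  shows "(\<lambda>n. padic_abs p (X n)) \<longlonglongrightarrow> padic_norm p (padic_null_ideal p +>\<^bsub>padic_Cauchy_ring p\<^esub> X)"
proof -
  let ?R = "padic_Cauchy_ring p" and ?I = "padic_null_ideal p"
  interpret I: ideal ?I ?R by (rule ideal_padic_null_ideal[OF p])
  have abs: "\<bar>padic_abs p a - padic_abs p b\<bar> \<le> padic_abs p (a - b)" for a b
  proof -
    have "padic_abs p a \<le> padic_abs p (a - b) + padic_abs p b"
      using padic_abs_triangle[OF p, of "a - b" b] by simp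
    moreover have "padic_abs p b \<le> padic_abs p (a - b) + padic_abs p a"
      using padic_abs_triangle[OF p, of "b - a" a] unfolding padic_abs_diff_comm[OF p, of b a] by simp
    ultimately show ?thesis by linarith
  qed
  have "Cauchy (\<lambda>n. padic_abs p (X n))"
    unfolding Cauchy_def dist_real_def
  proof (intro allI impI)
    fix e :: real assume "e > 0"
    then obtain N where "\<And>n m. N \<le> n \<Longrightarrow> N \<le> m \<Longrightarrow> padic_abs p (X n - X m) < e"
      using X[unfolded padic_Cauchy_ring_carrier[OF p], rule_format, of e] by auto
    thus "\<exists>N. \<forall>m\<ge>N. \<forall>n\<ge>N. \<bar>padic_abs p (X m) - padic_abs p (X n)\<bar> < e"
      by (intro exI[of _ N] allI impI) (rule le_less_trans[OF abs])
  qed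
  then obtain c where c: "(\<lambda>n. padic_abs p (X n)) \<longlonglongrightarrow> c"
    by (blast dest: real_Cauchy_convergent convergentD)
  have all: "(\<lambda>n. padic_abs p (Y n)) \<longlonglongrightarrow> c" if Y: "Y \<in> ?I +>\<^bsub>?R\<^esub> X" for Y
  proof -
    obtain h where h': "h \<in> ?I" "Y = h \<oplus>\<^bsub>?R\<^esub> X"
      using Y unfolding a_r_coset_def' by blast
    hence h: "h \<in> ?I" "Y = (\<lambda>n. h n + X n)" by (simp_all add: padic_Cauchy_ring_def)
    have "(\<lambda>n. padic_abs p (Y n) - padic_abs p (X n)) \<longlonglongrightarrow> 0"
    proof (rule Lim_null_comparison)
      show "\<forall>\<^sub>F n in sequentially. norm (padic_abs p (Y n) - padic_abs p (X n)) \<le> padic_abs p (h n)"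
      proof (intro always_eventually allI)
        fix n
        have "Y n - X n = h n" unfolding h(2) by (rule add_diff_cancel_right')
        thus "norm (padic_abs p (Y n) - padic_abs p (X n)) \<le> padic_abs p (h n)"
          using abs[of "Y n" "X n"] unfolding real_norm_def by (rule subst)
      qed
      show "(\<lambda>n. padic_abs p (h n)) \<longlonglongrightarrow> 0" using h(1) unfolding padic_null_ideal_def by blast
    qed
    from tendsto_add[OF this c] show ?thesis by simp
  qed
  have self: "X \<in> ?I +>\<^bsub>?R\<^esub> X" by (rule I.a_rcos_self[OF X])
  have "padic_norm p (?I +>\<^bsub>?R\<^esub> X) = c"
    unfolding padic_norm_def
  proof (rule the_equality)
    show "\<forall>Y\<in>?I +>\<^bsub>?R\<^esub> X. (\<lambda>n. padic_abs p (Y n)) \<longlonglongrightarrow> c" by (intro ballI all)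
    fix c' assume "\<forall>Y\<in>?I +>\<^bsub>?R\<^esub> X. (\<lambda>n. padic_abs p (Y n)) \<longlonglongrightarrow> c'"
    from bspec[OF this self] c show "c' = c" by (rule LIMSEQ_unique)
  qed
  with c show ?thesis by simp
qed

lemma padic_norm_diff_coset:
  assumes p: "prime p" and XY: "X \<in> carrier (padic_Cauchy_ring p)" "Y \<in> carrier (padic_Cauchy_ring p)"
  shows "(\<lambda>n. padic_abs p (X n - Y n)) \<longlonglongrightarrow>
    padic_norm p ((padic_null_ideal p +>\<^bsub>padic_Cauchy_ring p\<^esub> X) \<ominus>\<^bsub>padic_field p\<^esub>
      (padic_null_ideal p +>\<^bsub>padic_Cauchy_ring p\<^esub> Y))"
proof -
  interpret cring "padic_Cauchy_ring p" by (rule cring_padic_Cauchy_ring[OF p])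
  have "(\<lambda>n. X n - Y n) \<in> carrier (padic_Cauchy_ring p)"
    using minus_closed[OF XY] by (simp add: padic_Cauchy_ring_minus[OF p XY])
  from padic_norm_coset[OF p this] show ?thesis by (simp add: padic_field_coset_minus[OF p XY])
qed

lemma padic_dist:
  assumes p: "prime p" and x: "x \<in> carrier (padic_field p)" and y: "y \<in> carrier (padic_field p)"
  shows padic_dist_nonneg: "padic_norm p (x \<ominus>\<^bsub>padic_field p\<^esub> y) \<ge> 0"
    and padic_dist_commute: "padic_norm p (x \<ominus>\<^bsub>padic_field p\<^esub> y) = padic_norm p (y \<ominus>\<^bsub>padic_field p\<^esub> x)"
    and padic_dist_zero: "padic_norm p (x \<ominus>\<^bsub>padic_field p\<^esub> y) = 0 \<longleftrightarrow> x = y"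
    and padic_dist_triangle: "z \<in> carrier (padic_field p) \<Longrightarrow> padic_norm p (x \<ominus>\<^bsub>padic_field p\<^esub> z) \<le>
      padic_norm p (x \<ominus>\<^bsub>padic_field p\<^esub> y) + padic_norm p (y \<ominus>\<^bsub>padic_field p\<^esub> z)"
proof -
  let ?R = "padic_Cauchy_ring p" and ?I = "padic_null_ideal p"
  let ?d = "\<lambda>x y. padic_norm p (x \<ominus>\<^bsub>padic_field p\<^esub> y)"
  note lim = padic_norm_diff_coset[OF p]
  interpret I: ideal ?I ?R by (rule ideal_padic_null_ideal[OF p])
  obtain X where X: "X \<in> carrier ?R" "x = ?I +>\<^bsub>?R\<^esub> X" using padic_field_cases[OF p x] .
  obtain Y where Y: "Y \<in> carrier ?R" "y = ?I +>\<^bsub>?R\<^esub> Y" using padic_field_cases[OF p y] .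
  show "?d x y \<ge> 0"
    unfolding X(2) Y(2) by (rule LIMSEQ_le_const[OF lim[OF X(1) Y(1)]]) simp
  have "(\<lambda>n. padic_abs p (X n - Y n)) = (\<lambda>n. padic_abs p (Y n - X n))"
    by (intro ext padic_abs_diff_comm[OF p])
  thus "?d x y = ?d y x"
    unfolding X(2) Y(2) using lim[OF X(1) Y(1)] lim[OF Y(1) X(1)] LIMSEQ_unique by metis
  have XY: "X \<ominus>\<^bsub>?R\<^esub> Y = (\<lambda>n. X n - Y n)" by (rule padic_Cauchy_ring_minus[OF p X(1) Y(1)])
  have c: "(\<lambda>n. X n - Y n) \<in> carrier ?R" using I.minus_closed[OF X(1) Y(1)] XY by simp
  have "?d x y = 0 \<longleftrightarrow> (\<lambda>n. padic_abs p (X n - Y n)) \<longlonglongrightarrow> 0"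
    using lim[OF X(1) Y(1)] LIMSEQ_unique[OF lim[OF X(1) Y(1)], of 0] unfolding X(2) Y(2) by auto
  also have "\<dots> \<longleftrightarrow> X \<ominus>\<^bsub>?R\<^esub> Y \<in> ?I" unfolding XY padic_null_ideal_def using c by blast
  also have "\<dots> \<longleftrightarrow> x = y"
    unfolding X(2) Y(2) by (rule I.quotient_eq_iff_same_a_r_cos[OF I.ideal_axioms X(1) Y(1)])
  finally show "?d x y = 0 \<longleftrightarrow> x = y" .
  assume z: "z \<in> carrier (padic_field p)"
  obtain Z where Z: "Z \<in> carrier ?R" "z = ?I +>\<^bsub>?R\<^esub> Z" using padic_field_cases[OF p z] .
  show "?d x z \<le> ?d x y + ?d y z" unfolding X(2) Y(2) Z(2)
  proof (rule LIMSEQ_le[OF lim[OF X(1) Z(1)] tendsto_add[OF lim[OF X(1) Y(1)] lim[OF Y(1) Z(1)]]])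
    have "padic_abs p (X n - Z n) \<le> padic_abs p (X n - Y n) + padic_abs p (Y n - Z n)" for n
      using padic_abs_triangle[OF p, of "X n - Y n" "Y n - Z n"] by simp
    thus "\<exists>N. \<forall>n\<ge>N. padic_abs p (X n - Z n) \<le> padic_abs p (X n - Y n) + padic_abs p (Y n - Z n)"
      by blast
  qed
qed


section \<open>The space \<open>X\<^sub>P\<close>\<close>

text \<open>The \<open>p\<close>-adic coordinates are indexed by the primes \<open>p \<in> P\<close> themselves.\<close>

type_synonym point = "real \<times> (nat \<Rightarrow> padic)"

definition XP :: "nat set \<Rightarrow> point set" where
  "XP P = UNIV \<times> (\<Pi>\<^sub>E p\<in>P. carrier (padic_field p))"

text \<open>The value \<open>0\<close> off \<^const>\<open>XP\<close> is junk: \<^locale>\<open>Metric_space\<close> requires symmetry and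
  nonnegativity on the whole type.\<close>

definition XP_dist :: "nat set \<Rightarrow> point \<Rightarrow> point \<Rightarrow> real" where
  "XP_dist P x z =
     (if x \<in> XP P \<and> z \<in> XP P
      then max \<bar>fst x - fst z\<bar>
             (SUP p\<in>P. inverse (real p) * padic_norm p (snd x p \<ominus>\<^bsub>padic_field p\<^esub> snd z p))
      else 0)"

definition XP_topology :: "nat set \<Rightarrow> point topology" where
  "XP_topology P = Metric_space.mtopology (XP P) (XP_dist P)"

definition closed_ball :: "nat set \<Rightarrow> point \<Rightarrow> real \<Rightarrow> point set" where
  "closed_ball P x r = Metric_space.mcball (XP P) (XP_dist P) x r"

lemma Metric_space_XP:
  assumes P: "finite P" "P \<noteq> {}" "\<forall>p\<in>P. prime p"
  shows "Metric_space (XP P) (XP_dist P)"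
proof
  let ?f = "\<lambda>x z p. inverse (real p) * padic_norm p (snd x p \<ominus>\<^bsub>padic_field p\<^esub> snd z p)"
  have carr: "snd x p \<in> carrier (padic_field p)" if "x \<in> XP P" "p \<in> P" for x p
    using that by (auto simp: XP_def)
  have le: "XP_dist P x z \<le> c \<longleftrightarrow> \<bar>fst x - fst z\<bar> \<le> c \<and> (\<forall>p\<in>P. ?f x z p \<le> c)"
    if "x \<in> XP P" "z \<in> XP P" for x z c
    using that P by (simp add: XP_dist_def cSUP_le_iff)
  show nonneg: "0 \<le> XP_dist P x z" for x z
    unfolding XP_dist_def by (auto simp: le_max_iff_disj)
  show "XP_dist P x z = XP_dist P z x" for x z
  proof (cases "x \<in> XP P \<and> z \<in> XP P")
    case True
    hence "?f x z p = ?f z x p" if "p \<in> P" for p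
      using padic_dist_commute[of p "snd x p" "snd z p"] P(3) carr that by simp
    hence "?f x z ` P = ?f z x ` P" by (intro image_cong refl) simp
    thus ?thesis using True by (simp add: XP_dist_def abs_minus_commute)
  qed (auto simp: XP_dist_def)
  show "XP_dist P x z = 0 \<longleftrightarrow> x = z" if xz: "x \<in> XP P" "z \<in> XP P" for x z
  proof -
    have "XP_dist P x z = 0 \<longleftrightarrow> XP_dist P x z \<le> 0" using nonneg[of x z] by linarith
    also have "\<dots> \<longleftrightarrow> fst x = fst z \<and> (\<forall>p\<in>P. snd x p = snd z p)"
    proof -
      have "?f x z p \<le> 0 \<longleftrightarrow> snd x p = snd z p" if "p \<in> P" for p
      proof -
        have p: "prime p" "real p > 0" using that P prime_gt_0_nat by auto
        note c = carr[OF xz(1) that] carr[OF xz(2) that]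
        show ?thesis
          using padic_dist_zero[OF p(1) c] padic_dist_nonneg[OF p(1) c] p(2)
          by (auto simp: mult_le_0_iff)
      qed
      thus ?thesis by (auto simp: le[OF xz])
    qed
    also have "\<dots> \<longleftrightarrow> x = z"
    proof
      assume *: "fst x = fst z \<and> (\<forall>p\<in>P. snd x p = snd z p)"
      have "snd x = snd z"
        by (rule PiE_ext[of _ P "\<lambda>p. carrier (padic_field p)"]) (use xz * in \<open>auto simp: XP_def\<close>)
      thus "x = z" using * by (simp add: prod_eq_iff)
    qed simp
    finally show ?thesis .
  qed
  show "XP_dist P x w \<le> XP_dist P x z + XP_dist P z w"
    if xzw: "x \<in> XP P" "z \<in> XP P" "w \<in> XP P" for x z w
    unfolding le[OF xzw(1,3)]
  proof (intro conjI ballI)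
    have 1: "\<bar>fst x - fst z\<bar> \<le> XP_dist P x z \<and> (\<forall>p\<in>P. ?f x z p \<le> XP_dist P x z)"
      by (rule iffD1[OF le[OF xzw(1,2)] order_refl])
    have 2: "\<bar>fst z - fst w\<bar> \<le> XP_dist P z w \<and> (\<forall>p\<in>P. ?f z w p \<le> XP_dist P z w)"
      by (rule iffD1[OF le[OF xzw(2,3)] order_refl])
    show "\<bar>fst x - fst w\<bar> \<le> XP_dist P x z + XP_dist P z w" using 1 2 by linarith
    fix p assume p: "p \<in> P"
    have pp: "prime p" using p P(3) by blast
    have "?f x w p \<le> ?f x z p + ?f z w p"
      unfolding distrib_left[symmetric]
      by (rule mult_left_mono[OF padic_dist_triangle[OF pp carr[OF xzw(1) p] carr[OF xzw(2) p]
            carr[OF xzw(3) p]]]) simp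
    also have "\<dots> \<le> XP_dist P x z + XP_dist P z w"
      by (rule add_mono[OF bspec[OF conjunct2[OF 1] p] bspec[OF conjunct2[OF 2] p]])
    finally show "?f x w p \<le> XP_dist P x z + XP_dist P z w" .
  qed
qed

definition closed_balls :: "nat set \<Rightarrow> point set set" where
  "closed_balls P = {closed_ball P x r | x r. x \<in> XP P \<and> r > 0}"

definition ball_radius :: "nat set \<Rightarrow> point set \<Rightarrow> real" where
  "ball_radius P B = (THE r. r > 0 \<and> (\<exists>x\<in>XP P. B = closed_ball P x r))"

text \<open>The real coordinate makes the radius a function of the ball.\<close>

lemma fst_closed_ball:
  assumes P: "finite P" "P \<noteq> {}" "\<forall>p\<in>P. prime p" and x: "x \<in> XP P" and r: "r > 0"
  shows "fst ` closed_ball P x r = {fst x - r .. fst x + r}"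
proof -
  interpret Metric_space "XP P" "XP_dist P" by (rule Metric_space_XP[OF P])
  have "(t, snd x) \<in> closed_ball P x r" if "t \<in> {fst x - r .. fst x + r}" for t
  proof -
    have t: "(t, snd x) \<in> XP P" using x by (auto simp: XP_def)
    have "inverse (real p) * padic_norm p (snd x p \<ominus>\<^bsub>padic_field p\<^esub> snd x p) \<le> r" if "p \<in> P" for p
    proof -
      have "snd x p \<in> carrier (padic_field p)" using x that by (auto simp: XP_def)
      thus ?thesis using padic_dist_zero[of p "snd x p" "snd x p"] P(3) that r by simp
    qed
    thus ?thesis using t x that P by (auto simp: closed_ball_def XP_dist_def cSUP_le_iff)
  qed
  moreover have "fst y \<in> {fst x - r .. fst x + r}" if "y \<in> closed_ball P x r" for y
    using that by (auto simp: closed_ball_def XP_dist_def)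
  ultimately show ?thesis
    by (intro equalityI subsetI) (blast, metis fst_conv rev_image_eqI)
qed

lemma ball_radius_closed_ball:
  assumes P: "finite P" "P \<noteq> {}" "\<forall>p\<in>P. prime p" and x: "x \<in> XP P" and r: "r > 0"
  shows "ball_radius P (closed_ball P x r) = r"
  unfolding ball_radius_def
proof (rule the_equality)
  fix s assume "s > 0 \<and> (\<exists>y\<in>XP P. closed_ball P x r = closed_ball P y s)"
  then obtain y where y: "s > 0" "y \<in> XP P" "closed_ball P x r = closed_ball P y s" by blast
  have "{fst x - r .. fst x + r} = {fst y - s .. fst y + s}"
    using fst_closed_ball[OF P x r] fst_closed_ball[OF P y(2,1)] y(3) by metis
  hence "fst x - r = fst y - s \<and> fst x + r = fst y + s" using r y(1) by (simp only: Icc_eq_Icc) linarith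
  thus "s = r" by linarith
qed (use x r in auto)

definition invertible_affine_hom :: "nat set \<Rightarrow> (point \<Rightarrow> point) \<Rightarrow> bool" where
  "invertible_affine_hom P \<Psi> \<longleftrightarrow>
     (\<exists>D::rat. \<exists>a\<in>XP P. D \<noteq> 0 \<and>
        (\<forall>x\<in>XP P. \<Psi> x =
           (of_rat D * fst x + fst a,
            \<lambda>p\<in>P. padic_of_rat p D \<otimes>\<^bsub>padic_field p\<^esub> snd x p \<oplus>\<^bsub>padic_field p\<^esub> snd a p)))"


section \<open>Cylinders\<close>

text \<open>The constraining coordinate \<open>i\<close> is \<open>0\<close> for the real coordinate and \<open>i = p \<in> P\<close> for the
  \<open>p\<close>-adic one.\<close>

definition cylinder :: "nat set \<Rightarrow> point \<Rightarrow> real \<Rightarrow> nat \<Rightarrow> point set" where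
  "cylinder P x \<epsilon> i =
     (if i = 0 then {z \<in> XP P. \<bar>fst z - fst x\<bar> < \<epsilon>}
      else {z \<in> XP P. padic_norm i (snd z i \<ominus>\<^bsub>padic_field i\<^esub> snd x i) < real i * \<epsilon>})"

definition cylinder_radius :: "nat set \<Rightarrow> point \<Rightarrow> real \<Rightarrow> nat \<Rightarrow> real" where
  "cylinder_radius P x \<epsilon> i =
     (if i = 0 then \<epsilon> else Inf {\<epsilon>'. \<epsilon>' > 0 \<and> cylinder P x \<epsilon>' i = cylinder P x \<epsilon> i})"


section \<open>The cylinder absolute game\<close>

text \<open>Moves of both players are sets; \<^term>\<open>B\<close> is Bob's current ball.\<close>

definition alice_legal :: "nat set \<Rightarrow> real \<Rightarrow> point set \<Rightarrow> point set \<Rightarrow> bool" where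
  "alice_legal P \<beta> B C \<longleftrightarrow>
     (\<exists>x\<in>XP P. \<exists>\<epsilon>>0. \<exists>i\<in>insert 0 P.
        C = cylinder P x \<epsilon> i \<and> cylinder_radius P x \<epsilon> i \<le> \<beta> * ball_radius P B)"

definition bob_legal :: "nat set \<Rightarrow> real \<Rightarrow> point set \<Rightarrow> point set \<Rightarrow> point set \<Rightarrow> bool" where
  "bob_legal P \<beta> B C B' \<longleftrightarrow>
     B' \<in> closed_balls P \<and> B' \<subseteq> B - C \<and> ball_radius P B' \<ge> \<beta> * ball_radius P B"

text \<open>A strategy for Alice maps the list \<open>[B\<^sub>0, \<dots>, B\<^sub>n]\<close> of Bob's moves so far to her next
  cylinder \<open>C\<^bsub>n+1\<^esub>\<close>; her own earlier moves are determined by the strategy and need not be recorded.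
  The following predicate says that \<open>Bs\<close> is a nonempty list of legal moves of Bob against \<open>\<sigma>\<close>.\<close>

definition bob_play :: "nat set \<Rightarrow> real \<Rightarrow> (point set list \<Rightarrow> point set) \<Rightarrow> point set list \<Rightarrow> bool" where
  "bob_play P \<beta> \<sigma> Bs \<longleftrightarrow>
     Bs \<noteq> [] \<and> Bs ! 0 \<in> closed_balls P \<and>
     (\<forall>j. Suc j < length Bs \<longrightarrow> bob_legal P \<beta> (Bs ! j) (\<sigma> (take (Suc j) Bs)) (Bs ! Suc j))"

definition winning_strategy ::
  "nat set \<Rightarrow> real \<Rightarrow> point set \<Rightarrow> (point set list \<Rightarrow> point set) \<Rightarrow> bool" where
  "winning_strategy P \<beta> F \<sigma> \<longleftrightarrow>
     (\<forall>Bs. bob_play P \<beta> \<sigma> Bs \<longrightarrow>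
        alice_legal P \<beta> (last Bs) (\<sigma> Bs) \<and> (\<exists>B'. bob_legal P \<beta> (last Bs) (\<sigma> Bs) B')) \<and>
     (\<forall>B. (\<forall>n. bob_play P \<beta> \<sigma> (map B [0..<Suc n])) \<longrightarrow> (\<Inter>j. B j) \<inter> F \<noteq> {})"

definition cylinder_absolute_winning_beta :: "nat set \<Rightarrow> real \<Rightarrow> point set \<Rightarrow> bool" where
  "cylinder_absolute_winning_beta P \<beta> F \<longleftrightarrow> (\<exists>\<sigma>. winning_strategy P \<beta> F \<sigma>)"

definition CAW_bounds :: "nat set \<Rightarrow> point set \<Rightarrow> real set" where
  "CAW_bounds P F =
     {\<beta>\<^sub>1. 0 < \<beta>\<^sub>1 \<and> \<beta>\<^sub>1 \<le> 1 / 3 \<and> (\<forall>\<beta>\<in>{0<..<\<beta>\<^sub>1}. cylinder_absolute_winning_beta P \<beta> F)}"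

definition CAW :: "nat set \<Rightarrow> point set \<Rightarrow> bool" where
  "CAW P F \<longleftrightarrow> CAW_bounds P F \<noteq> {}"

definition CAW_dim :: "nat set \<Rightarrow> point set \<Rightarrow> real" where
  "CAW_dim P F = Sup (CAW_bounds P F)"

end

(* Winning passes to supersets, so only the preimage of S matters.  In each coordinate i the
   map Psi stretches distances by the factor |D|_i.  Alice pretends that S is attacked with a
   much smaller parameter by the balls B(Psi x, 2 M r), where B(x, r) is every (N + 1)-st ball of Bob
   and M = max |D|_i.  In between she first plays the pullback of the winning answer, enlarged to the
   full radius she is allowed, and then N cylinders around the real centre of Bob's ball: each of
   them at least halves the radius, until the stretched ball is small enough to miss the
   original cylinder.  The radii tend to 0, so the point of S she reaches pulls back to the
   common point of Bob's balls.  Bob never gets stuck because a cylinder of radius at most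
   beta r < r / p misses a coset inside the p-adic ball, and beta < 1/3 leaves room in the real one. *)

theory Submission
  imports Defs
begin

section \<open>The norm on the \<open>p\<close>-adic numbers\<close>

lemma padic_of_rat_ring_hom:
  assumes p: "prime p"
  shows "padic_of_rat p q \<in> carrier (padic_field p)"
    and "padic_of_rat p 1 = \<one>\<^bsub>padic_field p\<^esub>"
    and "padic_of_rat p (q * r) = padic_of_rat p q \<otimes>\<^bsub>padic_field p\<^esub> padic_of_rat p r"
proof -
  interpret I: ideal "padic_null_ideal p" "padic_Cauchy_ring p" by (rule ideal_padic_null_ideal[OF p])
  interpret h: ring_hom_ring "padic_Cauchy_ring p" "padic_field p"
    "(+>\<^bsub>padic_Cauchy_ring p\<^esub>) (padic_null_ideal p)"
    unfolding padic_field_def by (rule I.rcos_ring_hom_ring)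
  have c: "(\<lambda>_. q) \<in> carrier (padic_Cauchy_ring p)" for q
    by (simp add: padic_Cauchy_ring_carrier[OF p])
  show "padic_of_rat p q \<in> carrier (padic_field p)"
    unfolding padic_of_rat_def using c by (rule h.hom_closed)
  show "padic_of_rat p 1 = \<one>\<^bsub>padic_field p\<^esub>"
    using h.hom_one by (simp add: padic_of_rat_def padic_Cauchy_ring_def)
  show "padic_of_rat p (q * r) = padic_of_rat p q \<otimes>\<^bsub>padic_field p\<^esub> padic_of_rat p r"
    using h.hom_mult[OF c[of q] c[of r]] by (simp add: padic_of_rat_def padic_Cauchy_ring_def)
qed

text \<open>A constant sequence multiplies a Cauchy representative term by term, where
  \<open>padic_abs\<close> is multiplicative; uniqueness of limits gives the rest.\<close>

lemma padic_norm_of_rat_mult: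
  assumes p: "prime p" and x: "x \<in> carrier (padic_field p)"
  shows "padic_norm p (padic_of_rat p q \<otimes>\<^bsub>padic_field p\<^esub> x) = padic_abs p q * padic_norm p x"
proof -
  let ?R = "padic_Cauchy_ring p"
  interpret I: ideal "padic_null_ideal p" ?R by (rule ideal_padic_null_ideal[OF p])
  interpret h: ring_hom_ring ?R "padic_field p" "(+>\<^bsub>?R\<^esub>) (padic_null_ideal p)"
    unfolding padic_field_def by (rule I.rcos_ring_hom_ring)
  obtain X where X: "X \<in> carrier ?R" "x = padic_null_ideal p +>\<^bsub>?R\<^esub> X"
    using padic_field_cases[OF p x] .
  have c: "(\<lambda>_. q) \<in> carrier ?R" by (simp add: padic_Cauchy_ring_carrier[OF p])
  have m: "(\<lambda>_. q) \<otimes>\<^bsub>?R\<^esub> X = (\<lambda>n. q * X n)" by (simp add: padic_Cauchy_ring_def)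
  have e: "padic_of_rat p q \<otimes>\<^bsub>padic_field p\<^esub> x = padic_null_ideal p +>\<^bsub>?R\<^esub> (\<lambda>n. q * X n)"
    using h.hom_mult[OF c X(1)] by (simp add: padic_of_rat_def X(2) m)
  have "(\<lambda>n. q * X n) \<in> carrier ?R" using I.m_closed[OF c X(1)] m by simp
  from padic_norm_coset[OF p this]
  have "(\<lambda>n. padic_abs p q * padic_abs p (X n)) \<longlonglongrightarrow>
      padic_norm p (padic_of_rat p q \<otimes>\<^bsub>padic_field p\<^esub> x)"
    by (simp add: e padic_abs_mult[OF p])
  moreover have "(\<lambda>n. padic_abs p q * padic_abs p (X n)) \<longlonglongrightarrow> padic_abs p q * padic_norm p x"
    unfolding X(2) by (intro tendsto_mult_left padic_norm_coset[OF p X(1)])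
  ultimately show ?thesis by (rule LIMSEQ_unique)
qed

lemma padic_norm_of_rat: "prime p \<Longrightarrow> padic_norm p (padic_of_rat p q) = padic_abs p q"
  using padic_norm_coset[of p "\<lambda>_. q"]
  by (simp add: padic_of_rat_def padic_Cauchy_ring_carrier LIMSEQ_const_iff)

text \<open>The strong triangle inequality holds term by term for rational representatives and
  survives the limit because the maximum is continuous.\<close>

lemma padic_norm_diff_ultrametric:
  assumes p: "prime p" and x: "x \<in> carrier (padic_field p)" and y: "y \<in> carrier (padic_field p)"
    and z: "z \<in> carrier (padic_field p)"
  shows "padic_norm p (x \<ominus>\<^bsub>padic_field p\<^esub> z) \<le>
    max (padic_norm p (x \<ominus>\<^bsub>padic_field p\<^esub> y)) (padic_norm p (y \<ominus>\<^bsub>padic_field p\<^esub> z))"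
proof -
  let ?R = "padic_Cauchy_ring p" and ?I = "padic_null_ideal p"
  note lim = padic_norm_diff_coset[OF p]
  obtain X where X: "X \<in> carrier ?R" "x = ?I +>\<^bsub>?R\<^esub> X" using padic_field_cases[OF p x] .
  obtain Y where Y: "Y \<in> carrier ?R" "y = ?I +>\<^bsub>?R\<^esub> Y" using padic_field_cases[OF p y] .
  obtain Z where Z: "Z \<in> carrier ?R" "z = ?I +>\<^bsub>?R\<^esub> Z" using padic_field_cases[OF p z] .
  show ?thesis unfolding X(2) Y(2) Z(2)
  proof (rule LIMSEQ_le[OF lim[OF X(1) Z(1)] tendsto_max[OF lim[OF X(1) Y(1)] lim[OF Y(1) Z(1)]]])
    have "padic_abs p (X n - Z n) \<le> max (padic_abs p (X n - Y n)) (padic_abs p (Y n - Z n))" for n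
      using padic_abs_ultrametric[OF p, of "X n - Y n" "Y n - Z n"] by simp
    thus "\<exists>N. \<forall>n\<ge>N. padic_abs p (X n - Z n) \<le>
        max (padic_abs p (X n - Y n)) (padic_abs p (Y n - Z n))" by blast
  qed
qed

lemma padic_affine_diff:
  assumes p: "prime p" and c: "x \<in> carrier (padic_field p)" "z \<in> carrier (padic_field p)"
    "a \<in> carrier (padic_field p)"
  shows "padic_norm p ((padic_of_rat p q \<otimes>\<^bsub>padic_field p\<^esub> x \<oplus>\<^bsub>padic_field p\<^esub> a) \<ominus>\<^bsub>padic_field p\<^esub>
      (padic_of_rat p q \<otimes>\<^bsub>padic_field p\<^esub> z \<oplus>\<^bsub>padic_field p\<^esub> a)) =
    padic_abs p q * padic_norm p (x \<ominus>\<^bsub>padic_field p\<^esub> z)"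
proof -
  interpret cring "padic_field p" by (rule cring_padic_field[OF p])
  note u = padic_of_rat_ring_hom(1)[OF p, of q]
  have "(padic_of_rat p q \<otimes>\<^bsub>padic_field p\<^esub> x \<oplus>\<^bsub>padic_field p\<^esub> a) \<ominus>\<^bsub>padic_field p\<^esub>
      (padic_of_rat p q \<otimes>\<^bsub>padic_field p\<^esub> z \<oplus>\<^bsub>padic_field p\<^esub> a) =
      padic_of_rat p q \<otimes>\<^bsub>padic_field p\<^esub> (x \<ominus>\<^bsub>padic_field p\<^esub> z)"
    using u c by algebra
  thus ?thesis using padic_norm_of_rat_mult[OF p] c by simp
qed

lemma padic_affine_surj:
  assumes p: "prime p" and c: "y \<in> carrier (padic_field p)" "a \<in> carrier (padic_field p)"
    and q: "q \<noteq> 0"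
  shows "\<exists>x\<in>carrier (padic_field p). padic_of_rat p q \<otimes>\<^bsub>padic_field p\<^esub> x \<oplus>\<^bsub>padic_field p\<^esub> a = y"
proof
  interpret cring "padic_field p" by (rule cring_padic_field[OF p])
  let ?u = "padic_of_rat p q" and ?v = "padic_of_rat p (inverse q)"
  note uv = padic_of_rat_ring_hom(1)[OF p, of q] padic_of_rat_ring_hom(1)[OF p, of "inverse q"]
  have 1: "?u \<otimes>\<^bsub>padic_field p\<^esub> ?v = \<one>\<^bsub>padic_field p\<^esub>"
    using padic_of_rat_ring_hom(2)[OF p] padic_of_rat_ring_hom(3)[OF p, of q "inverse q"] q by simp
  show "?v \<otimes>\<^bsub>padic_field p\<^esub> (y \<ominus>\<^bsub>padic_field p\<^esub> a) \<in> carrier (padic_field p)" using uv c by simp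
  have "?u \<otimes>\<^bsub>padic_field p\<^esub> (?v \<otimes>\<^bsub>padic_field p\<^esub> (y \<ominus>\<^bsub>padic_field p\<^esub> a)) =
      y \<ominus>\<^bsub>padic_field p\<^esub> a"
    using uv c 1 by (simp add: m_assoc[symmetric])
  thus "?u \<otimes>\<^bsub>padic_field p\<^esub> (?v \<otimes>\<^bsub>padic_field p\<^esub> (y \<ominus>\<^bsub>padic_field p\<^esub> a)) \<oplus>\<^bsub>padic_field p\<^esub> a = y"
    using c by (simp add: a_minus_def a_assoc l_neg)
qed

text \<open>The absolute value reverses the exponent: a nonnegative \<open>k\<close> calls for a
  power of \<open>p\<close> in the denominator, a negative one for a power in the numerator.\<close>

lemma padic_abs_prime_power_int:
  assumes p: "prime p"
  shows "\<exists>q. padic_abs p q = real p powi k"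
proof (cases "k \<ge> 0")
  case True
  have "padic_abs p (of_int 1 / of_int (int p ^ nat k)) = real p powi k"
    using p True prime_gt_1_nat[OF p] by (subst padic_abs_frac) (auto simp: multiplicity_same_power)
  thus ?thesis by blast
next
  case False
  have "padic_abs p (of_int (int p ^ nat (- k)) / of_int 1) = real p powi k"
    using p False prime_gt_1_nat[OF p] by (subst padic_abs_frac) (auto simp: multiplicity_same_power)
  thus ?thesis by blast
qed

text \<open>Supplies the second candidate centre when Bob has to leave a p-adic cylinder. Some power
  of \<open>p\<close> lies above \<open>r\<close> and is at most \<open>p * r\<close>;
  \<open>x\<close> is translated by a rational number of that absolute value.\<close>

lemma padic_translate:
  assumes p: "prime p" and x: "x \<in> carrier (padic_field p)" and r: "r > 0"
  shows "\<exists>y\<in>carrier (padic_field p). inverse (real p) * padic_norm p (y \<ominus>\<^bsub>padic_field p\<^esub> x) \<le> r \<and>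
    r / real p < inverse (real p) * padic_norm p (y \<ominus>\<^bsub>padic_field p\<^esub> x)"
proof -
  interpret cring "padic_field p" by (rule cring_padic_field[OF p])
  have p1: "real p > 1" using prime_gt_1_nat[OF p] by simp
  \<comment> \<open>The largest exponent with \<open>real p powi k\<close> at most
    \<open>real p * r\<close>; maximality forces the power above \<open>r\<close>.\<close>
  define k where "k = \<lfloor>log (real p) (real p * r)\<rfloor>"
  obtain q where q: "padic_abs p q = real p powi k" using padic_abs_prime_power_int[OF p] by blast
  have pw: "real p powi k = real p powr of_int k" using p1 by (simp add: powr_real_of_int')
  have "real p powr of_int k \<le> real p * r"
    using p1 r by (subst powr_le_iff) (auto simp: k_def)
  moreover have "real p * r < real p powr (of_int k + 1)"
    using p1 r by (subst less_powr_iff) (auto simp: k_def)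
  hence "r < real p powr of_int k" using p1 by (simp add: powr_add)
  moreover note u = padic_of_rat_ring_hom(1)[OF p, of q]
  have "(x \<oplus>\<^bsub>padic_field p\<^esub> padic_of_rat p q) \<ominus>\<^bsub>padic_field p\<^esub> x = padic_of_rat p q"
    using x u by algebra
  hence "padic_norm p ((x \<oplus>\<^bsub>padic_field p\<^esub> padic_of_rat p q) \<ominus>\<^bsub>padic_field p\<^esub> x) =
      real p powr of_int k"
    using padic_norm_of_rat[OF p] q pw by simp
  ultimately show ?thesis using x u p1
    by (intro bexI[of _ "x \<oplus>\<^bsub>padic_field p\<^esub> padic_of_rat p q"]) (auto simp: field_simps)
qed

section \<open>Coordinate distances\<close>

text \<open>With the weight \<open>inverse (real i)\<close> built in, balls and cylinders are
  described alike in the real and the p-adic coordinates: the distance is at most \<open>r\<close>,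
  respectively below \<open>\<epsilon>\<close>.\<close>

definition coord_dist :: "nat \<Rightarrow> point \<Rightarrow> point \<Rightarrow> real" where
  "coord_dist i x z =
     (if i = 0 then \<bar>fst x - fst z\<bar>
      else inverse (real i) * padic_norm i (snd x i \<ominus>\<^bsub>padic_field i\<^esub> snd z i))"

locale prime_set =
  fixes P :: "nat set"
  assumes P: "finite P" "P \<noteq> {}" "\<forall>p\<in>P. prime p"
begin

sublocale Metric_space "XP P" "XP_dist P" by (rule Metric_space_XP[OF P])

lemma prime_coord: "i \<in> insert 0 P \<Longrightarrow> i \<noteq> 0 \<Longrightarrow> prime i"
  using P(3) by auto

lemma coord_carrier: "x \<in> XP P \<Longrightarrow> p \<in> P \<Longrightarrow> snd x p \<in> carrier (padic_field p)"
  by (auto simp: XP_def)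

lemma zero_notin: "0 \<notin> P"
  using P(3) by fastforce

lemma coord_dist_commute:
  assumes "i \<in> insert 0 P" "x \<in> XP P" "z \<in> XP P"
  shows "coord_dist i x z = coord_dist i z x"
proof (cases "i = 0")
  case False
  hence "i \<in> P" using assms by auto
  thus ?thesis using False
      padic_dist_commute[OF prime_coord[OF assms(1) False] coord_carrier[OF assms(2)] coord_carrier[OF assms(3)]]
    by (simp add: coord_dist_def)
qed (simp add: coord_dist_def)

lemma coord_dist_triangle:
  assumes "i \<in> insert 0 P" "x \<in> XP P" "y \<in> XP P" "z \<in> XP P"
  shows "coord_dist i x z \<le> coord_dist i x y + coord_dist i y z"
proof (cases "i = 0")
  case False
  hence i: "i \<in> P" using assms by auto
  have "padic_norm i (snd x i \<ominus>\<^bsub>padic_field i\<^esub> snd z i) \<le>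
      padic_norm i (snd x i \<ominus>\<^bsub>padic_field i\<^esub> snd y i) + padic_norm i (snd y i \<ominus>\<^bsub>padic_field i\<^esub> snd z i)"
    by (rule padic_dist_triangle) (use prime_coord[OF assms(1) False] coord_carrier assms i in auto)
  thus ?thesis using False
    by (simp add: coord_dist_def distrib_left[symmetric] mult_left_mono)
qed (simp add: coord_dist_def)

lemma coord_dist_ultrametric:
  assumes "i \<in> P" "x \<in> XP P" "y \<in> XP P" "z \<in> XP P"
  shows "coord_dist i x z \<le> max (coord_dist i x y) (coord_dist i y z)"
proof -
  have i: "prime i" "i \<noteq> 0" using assms(1) P(3) zero_notin by metis+
  have "padic_norm i (snd x i \<ominus>\<^bsub>padic_field i\<^esub> snd z i) \<le>
      max (padic_norm i (snd x i \<ominus>\<^bsub>padic_field i\<^esub> snd y i)) (padic_norm i (snd y i \<ominus>\<^bsub>padic_field i\<^esub> snd z i))"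
    by (rule padic_norm_diff_ultrametric) (use i coord_carrier assms in auto)
  hence "inverse (real i) * padic_norm i (snd x i \<ominus>\<^bsub>padic_field i\<^esub> snd z i) \<le> inverse (real i) *
      max (padic_norm i (snd x i \<ominus>\<^bsub>padic_field i\<^esub> snd y i)) (padic_norm i (snd y i \<ominus>\<^bsub>padic_field i\<^esub> snd z i))"
    by (intro mult_left_mono) auto
  thus ?thesis using i by (simp add: coord_dist_def max_mult_distrib_left)
qed

lemma coord_dist_refl:
  assumes i: "i \<in> insert 0 P" and x: "x \<in> XP P"
  shows "coord_dist i x x = 0"
proof (cases "i = 0")
  case False
  hence "snd x i \<in> carrier (padic_field i)" using i coord_carrier[OF x] by blast
  thus ?thesis using False padic_dist_zero[OF prime_coord[OF i False]] by (simp add: coord_dist_def)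
qed (simp add: coord_dist_def)

lemma XP_dist_le_iff:
  assumes "x \<in> XP P" "z \<in> XP P"
  shows "XP_dist P x z \<le> c \<longleftrightarrow> (\<forall>i\<in>insert 0 P. coord_dist i x z \<le> c)"
proof -
  have "(SUP p\<in>P. inverse (real p) * padic_norm p (snd x p \<ominus>\<^bsub>padic_field p\<^esub> snd z p)) =
      (SUP p\<in>P. coord_dist p x z)"
    using zero_notin by (intro SUP_cong) (auto simp: coord_dist_def)
  moreover have "\<bar>fst x - fst z\<bar> = coord_dist 0 x z" by (simp add: coord_dist_def)
  ultimately show ?thesis using assms P(1,2)
    by (simp add: XP_dist_def cSUP_le_iff)
qed

lemma coord_dist_le_XP_dist:
  "i \<in> insert 0 P \<Longrightarrow> x \<in> XP P \<Longrightarrow> z \<in> XP P \<Longrightarrow> coord_dist i x z \<le> XP_dist P x z"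
  using XP_dist_le_iff by blast

lemma mem_closed_ball:
  "x \<in> XP P \<Longrightarrow> z \<in> closed_ball P x r \<longleftrightarrow> z \<in> XP P \<and> (\<forall>i\<in>insert 0 P. coord_dist i x z \<le> r)"
  unfolding closed_ball_def in_mcball using XP_dist_le_iff by blast

lemma mem_cylinder:
  assumes "i \<in> insert 0 P" "x \<in> XP P"
  shows "z \<in> cylinder P x \<epsilon> i \<longleftrightarrow> z \<in> XP P \<and> coord_dist i x z < \<epsilon>"
proof (cases "z \<in> XP P")
  case True
  have "i \<noteq> 0 \<Longrightarrow> real i > 0" by simp
  thus ?thesis using True coord_dist_commute[OF assms True]
    by (auto simp: cylinder_def coord_dist_def field_simps)
qed (auto simp: cylinder_def)

lemma cylinder_radius_le:
  assumes "\<epsilon> > 0" shows "cylinder_radius P x \<epsilon> i \<le> \<epsilon>"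
proof -
  have "Inf {\<epsilon>'. \<epsilon>' > 0 \<and> cylinder P x \<epsilon>' i = cylinder P x \<epsilon> i} \<le> \<epsilon>"
    by (rule cInf_lower) (use assms in \<open>auto intro!: bdd_belowI[of _ 0]\<close>)
  thus ?thesis by (simp add: cylinder_radius_def)
qed

text \<open>A p-adic cylinder may have a radius smaller than its parameter. A point of it lies in
  every equal cylinder, so its distance is below each parameter in the infimum; only the weak
  inequality passes to the infimum.\<close>

lemma coord_dist_le_cylinder_radius:
  assumes "i \<in> insert 0 P" "x \<in> XP P" "\<epsilon> > 0" "z \<in> cylinder P x \<epsilon> i"
  shows "coord_dist i x z \<le> cylinder_radius P x \<epsilon> i"
proof (cases "i = 0")
  case True thus ?thesis using assms mem_cylinder by (simp add: cylinder_radius_def)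
next
  case False
  have "coord_dist i x z \<le> Inf {\<epsilon>'. \<epsilon>' > 0 \<and> cylinder P x \<epsilon>' i = cylinder P x \<epsilon> i}"
  proof (rule cInf_greatest)
    fix e assume "e \<in> {\<epsilon>'. \<epsilon>' > 0 \<and> cylinder P x \<epsilon>' i = cylinder P x \<epsilon> i}"
    hence "z \<in> cylinder P x e i" using assms(4) by simp
    thus "coord_dist i x z \<le> e" using mem_cylinder[OF assms(1,2)] by simp
  qed (use assms(3) in auto)
  thus ?thesis using False by (simp add: cylinder_radius_def)
qed

text \<open>Reduces a cylinder given by an arbitrary strategy to a centre, a coordinate and one weak
  bound, uniformly for both kinds of coordinates.\<close>

lemma alice_legalE:
  assumes "alice_legal P \<beta> B C"
  obtains c i where "c \<in> XP P" "i \<in> insert 0 P"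
    "\<And>z. z \<in> C \<Longrightarrow> z \<in> XP P \<and> coord_dist i c z \<le> \<beta> * ball_radius P B"
proof -
  obtain x \<epsilon> i where *: "x \<in> XP P" "\<epsilon> > 0" "i \<in> insert 0 P" "C = cylinder P x \<epsilon> i"
    "cylinder_radius P x \<epsilon> i \<le> \<beta> * ball_radius P B"
    using assms unfolding alice_legal_def by blast
  show thesis
  proof (rule that[OF *(1,3)])
    fix z assume "z \<in> C"
    thus "z \<in> XP P \<and> coord_dist i x z \<le> \<beta> * ball_radius P B"
      using coord_dist_le_cylinder_radius[OF *(3,1,2)] mem_cylinder[OF *(3,1)] *(4,5) order_trans by metis
  qed
qed

lemma closed_ballsE:
  assumes "B \<in> closed_balls P"
  obtains x where "x \<in> XP P" "ball_radius P B > 0" "B = closed_ball P x (ball_radius P B)"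
proof -
  obtain x r where "x \<in> XP P" "r > 0" "B = closed_ball P x r"
    using assms unfolding closed_balls_def by blast
  thus thesis using that ball_radius_closed_ball[OF P] by metis
qed

text \<open>The radius of a cylinder never exceeds its parameter, so the full allowance may be used
  as the parameter.\<close>

lemma alice_legal_cylinder:
  assumes "B \<in> closed_balls P" "0 < \<beta>" "c \<in> XP P" "i \<in> insert 0 P"
  shows "alice_legal P \<beta> B (cylinder P c (\<beta> * ball_radius P B) i)"
proof -
  have pos: "\<beta> * ball_radius P B > 0" by (metis closed_ballsE[OF assms(1)] assms(2) mult_pos_pos)
  show ?thesis unfolding alice_legal_def using cylinder_radius_le[OF pos] pos assms(3,4) by blast
qed

section \<open>Moves\<close>

text \<open>A ball of radius exactly \<open>\<beta> * r\<close> is found. Against a real cylinder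
  its centre is pushed to the far side of \<open>B\<close>. Against a p-adic cylinder there are two
  candidates, whose centres are too far apart in that coordinate for the cylinder to meet both
  balls.\<close>

lemma bob_can_move:
  assumes \<beta>: "0 < \<beta>" "\<beta> < 1 / 3" "\<And>p. p \<in> P \<Longrightarrow> \<beta> < 1 / real p"
    and B: "B \<in> closed_balls P" and C: "alice_legal P \<beta> B C"
  shows "\<exists>B'. bob_legal P \<beta> B C B'"
proof -
  define r where "r = ball_radius P B"
  obtain x where x: "x \<in> XP P" "r > 0" "B = closed_ball P x r"
    using closed_ballsE[OF B] unfolding r_def by blast
  obtain c i where c: "c \<in> XP P" "i \<in> insert 0 P"
    "\<And>z. z \<in> C \<Longrightarrow> z \<in> XP P \<and> coord_dist i c z \<le> \<beta> * r"
    using alice_legalE[OF C] unfolding r_def by blast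
  have br: "\<beta> * r > 0" "\<beta> * r \<le> r" using \<beta> x by (auto simp: field_simps)
  have move: "\<exists>B'. bob_legal P \<beta> B C B'"
    if y: "y \<in> XP P" and sub: "closed_ball P y (\<beta> * r) \<subseteq> B" and disj: "closed_ball P y (\<beta> * r) \<inter> C = {}"
    for y
  proof
    have "closed_ball P y (\<beta> * r) \<in> closed_balls P" unfolding closed_balls_def using y br(1) by blast
    moreover have "closed_ball P y (\<beta> * r) \<subseteq> B - C" using sub disj by blast
    ultimately show "bob_legal P \<beta> B C (closed_ball P y (\<beta> * r))"
      using ball_radius_closed_ball[OF P y br(1)] by (simp add: bob_legal_def r_def)
  qed
  show ?thesis
  proof (cases "i = 0")
    case True
    \<comment> \<open>The sign points away from the real centre of the cylinder; the shift by
      \<open>(1 - \<beta>) * r\<close> still keeps the new ball inside \<open>B\<close>.\<close>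
    define s :: real where "s = (if fst c \<le> fst x then 1 else - 1)"
    define y where "y = (fst x + s * ((1 - \<beta>) * r), snd x)"
    have y: "y \<in> XP P" using x(1) unfolding y_def XP_def by auto
    \<comment> \<open>Here \<open>\<beta> < 1 / 3\<close> enters: the shift must exceed the reach of
      the cylinder plus the radius of the new ball, each of size \<open>\<beta> * r\<close>.\<close>
    have \<beta>r: "(1 - \<beta>) * r > 2 * (\<beta> * r)" "(1 - \<beta>) * r + \<beta> * r = r"
      using \<beta>(2) x(2) by (simp_all add: field_simps)
    hence pos: "(1 - \<beta>) * r \<ge> 0" using br by linarith
    have cy: "coord_dist 0 c y \<ge> (1 - \<beta>) * r"
      using pos by (auto simp: y_def coord_dist_def s_def)
    have xy: "coord_dist j x y \<le> (1 - \<beta>) * r" if j: "j \<in> insert 0 P" for j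
    proof (cases "j = 0")
      case False
      hence "coord_dist j x y = coord_dist j x x" by (simp add: y_def coord_dist_def)
      thus ?thesis using coord_dist_refl[OF j x(1)] pos by simp
    qed (use pos in \<open>auto simp: y_def coord_dist_def s_def\<close>)
    show ?thesis
    proof (rule move[OF y])
      show "closed_ball P y (\<beta> * r) \<subseteq> B"
      proof
        fix z assume "z \<in> closed_ball P y (\<beta> * r)"
        hence z: "z \<in> XP P" "\<And>j. j \<in> insert 0 P \<Longrightarrow> coord_dist j y z \<le> \<beta> * r"
          using mem_closed_ball[OF y] by auto
        have "coord_dist j x z \<le> r" if j: "j \<in> insert 0 P" for j
          using coord_dist_triangle[OF j x(1) y z(1)] z(2)[OF j] xy[OF j] \<beta>r(2) by linarith
        thus "z \<in> B" unfolding x(3) mem_closed_ball[OF x(1)] using z(1) by blast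
      qed
      have False if z: "z \<in> closed_ball P y (\<beta> * r)" "z \<in> C" for z
      proof -
        have "z \<in> XP P" "coord_dist i y z \<le> \<beta> * r" using z(1) c(2) mem_closed_ball[OF y] by auto
        thus False
          using coord_dist_triangle[OF c(2) c(1), of z y] c(3)[OF z(2)] coord_dist_commute[OF c(2) y, of z] y
            cy \<beta>r(1) True by simp
      qed
      thus "closed_ball P y (\<beta> * r) \<inter> C = {}" by blast
    qed
  next
    case False
    hence i: "i \<in> P" using c by auto
    have ii: "prime i" using i P by auto
    \<comment> \<open>The other centre differs from \<open>x\<close> only in coordinate
      \<open>i\<close>, by an amount that stays within \<open>r\<close> but exceeds
      \<open>r / real i\<close>, hence also \<open>\<beta> * r\<close>.\<close>
    obtain u where u: "u \<in> carrier (padic_field i)"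
      "inverse (real i) * padic_norm i (u \<ominus>\<^bsub>padic_field i\<^esub> snd x i) \<le> r"
      "r / real i < inverse (real i) * padic_norm i (u \<ominus>\<^bsub>padic_field i\<^esub> snd x i)"
      using padic_translate[OF ii coord_carrier[OF x(1) i] x(2)] by blast
    define y where "y = (fst x, (snd x)(i := u))"
    have y: "y \<in> XP P" using x(1) u(1) i unfolding y_def XP_def by (auto simp: PiE_iff extensional_def)
    have yx: "coord_dist j y x \<le> r" if "j \<in> insert 0 P" for j
    proof (cases "j = i")
      case False
      hence "coord_dist j y x = coord_dist j x x" using i zero_notin by (auto simp: y_def coord_dist_def)
      thus ?thesis using coord_dist_refl[OF that x(1)] x(2) by simp
    qed (use u False in \<open>simp add: y_def coord_dist_def\<close>)
    have far: "r / real i < coord_dist i y x" using u False by (simp add: y_def coord_dist_def)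
    have "\<beta> * r < r / real i" using mult_strict_right_mono[OF \<beta>(3)[OF i] x(2)] by simp
    \<comment> \<open>By the ultrametric inequality, a ball of radius \<open>\<beta> * r\<close>
      that meets \<open>C\<close> has its centre itself within \<open>\<beta> * r\<close> of
      \<open>c\<close>; the two radii do not add up.\<close>
    have near: "coord_dist i c w \<le> \<beta> * r"
      if w: "w \<in> XP P" and z: "z \<in> closed_ball P w (\<beta> * r)" "z \<in> C" for w z
    proof -
      have "z \<in> XP P" "coord_dist i w z \<le> \<beta> * r" using z(1) c(2) mem_closed_ball[OF w] by auto
      thus ?thesis
        using coord_dist_ultrametric[OF i c(1), of z w] c(3)[OF z(2)] coord_dist_commute[OF c(2) w] w
        by fastforce
    qed
    have "closed_ball P x (\<beta> * r) \<subseteq> B" unfolding x(3) subset_iff mem_closed_ball[OF x(1)]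
      using br by force
    moreover have "closed_ball P y (\<beta> * r) \<subseteq> B"
    proof
      fix z assume "z \<in> closed_ball P y (\<beta> * r)"
      hence z: "z \<in> XP P" "\<And>j. j \<in> insert 0 P \<Longrightarrow> coord_dist j y z \<le> \<beta> * r"
        using mem_closed_ball[OF y] by auto
      \<comment> \<open>In the real coordinate \<open>y\<close> agrees with \<open>x\<close>; in the
        p-adic ones the ultrametric inequality absorbs the shift.\<close>
      have "coord_dist j x z \<le> r" if j: "j \<in> insert 0 P" for j
      proof (cases "j = 0")
        case True
        hence "coord_dist j x z = coord_dist j y z" by (simp add: y_def coord_dist_def)
        thus ?thesis using z(2)[OF j] br by simp
      next
        case False
        hence "j \<in> P" using j by auto
        from coord_dist_ultrametric[OF this x(1) y z(1)] show ?thesis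
          using z(2)[OF j] yx[OF j] br coord_dist_commute[OF j x(1) y] by simp
      qed
      thus "z \<in> B" unfolding x(3) mem_closed_ball[OF x(1)] using z(1) by blast
    qed
    moreover have "closed_ball P x (\<beta> * r) \<inter> C = {} \<or> closed_ball P y (\<beta> * r) \<inter> C = {}"
    proof (rule ccontr)
      assume "\<not> ?thesis"
      hence "coord_dist i c x \<le> \<beta> * r" "coord_dist i c y \<le> \<beta> * r"
        using near[OF x(1)] near[OF y] by blast+
      hence "coord_dist i y x \<le> \<beta> * r"
        using coord_dist_ultrametric[OF i y c(1) x(1)] coord_dist_commute[OF c(2) c(1) y] by simp
      thus False using far \<open>\<beta> * r < r / real i\<close> by simp
    qed
    ultimately show ?thesis using move[OF x(1)] move[OF y] by argo
  qed
qed


section \<open>Centres and radii of Bob's balls\<close>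

text \<open>A ball is only a set of points, and its p-adic coordinates do not have a unique centre,
  so one is chosen.\<close>

definition centre :: "point set \<Rightarrow> point" where
  "centre B = (SOME x. x \<in> XP P \<and> B = closed_ball P x (ball_radius P B))"

lemma centre:
  assumes "B \<in> closed_balls P"
  shows "centre B \<in> XP P" "ball_radius P B > 0" "closed_ball P (centre B) (ball_radius P B) = B"
proof -
  have "\<exists>x. x \<in> XP P \<and> B = closed_ball P x (ball_radius P B)" by (metis closed_ballsE[OF assms])
  from someI_ex[OF this] show "centre B \<in> XP P" "closed_ball P (centre B) (ball_radius P B) = B"
    unfolding centre_def by auto
  show "ball_radius P B > 0" by (rule closed_ballsE[OF assms])
qed

lemma mem_ball:
  assumes "B \<in> closed_balls P"
  shows "z \<in> B \<longleftrightarrow> z \<in> XP P \<and> (\<forall>i\<in>insert 0 P. coord_dist i (centre B) z \<le> ball_radius P B)"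
  using mem_closed_ball[OF centre(1)[OF assms], of z "ball_radius P B"] unfolding centre(3)[OF assms] .

lemma centre_mem:
  assumes "B \<in> closed_balls P" shows "centre B \<in> B"
  unfolding mem_ball[OF assms] using centre[OF assms] coord_dist_refl by (simp add: less_imp_le)

lemma fst_ball:
  assumes "B \<in> closed_balls P"
  shows "fst ` B = {fst (centre B) - ball_radius P B .. fst (centre B) + ball_radius P B}"
  using fst_closed_ball[OF P centre(1,2)[OF assms]] unfolding centre(3)[OF assms] .

text \<open>The radius is visible in the real projection, an interval of twice that length.\<close>

lemma ball_radius_mono:
  assumes "B \<in> closed_balls P" "B' \<in> closed_balls P" "B' \<subseteq> B"
  shows "ball_radius P B' \<le> ball_radius P B"
proof -
  have "fst ` B' \<subseteq> fst ` B" using assms(3) by (rule image_mono)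
  thus ?thesis using centre(2)[OF assms(2)]
    unfolding fst_ball[OF assms(1)] fst_ball[OF assms(2)] atLeastatMost_subset_iff by linarith
qed

text \<open>The real interval of Bob's next ball lies on one side of the old centre, so Alice can force
  the radii to shrink.\<close>

lemma halving_move:
  assumes \<beta>: "0 < \<beta>" and B: "B \<in> closed_balls P"
    and B': "bob_legal P \<beta> B (cylinder P (centre B) (\<beta> * ball_radius P B) 0) B'"
  shows "ball_radius P B' \<le> ball_radius P B / 2"
proof -
  let ?x = "fst (centre B)" and ?r = "ball_radius P B" and ?x' = "fst (centre B')" and ?r' = "ball_radius P B'"
  have 1: "B' \<in> closed_balls P" "B' \<subseteq> B" "B' \<inter> cylinder P (centre B) (\<beta> * ?r) 0 = {}"
    using B' unfolding bob_legal_def by auto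
  have sub: "{?x' - ?r' .. ?x' + ?r'} \<subseteq> {?x - ?r .. ?x + ?r}"
    using image_mono[OF 1(2), of fst] unfolding fst_ball[OF B] fst_ball[OF 1(1)] .
  have "?x \<notin> fst ` B'"
  proof
    assume "?x \<in> fst ` B'"
    then obtain z where z: "z \<in> B'" "fst z = ?x" by force
    have "z \<in> XP P" using z(1) mem_ball[OF 1(1)] by blast
    moreover have "0 < \<beta> * ?r" using \<beta> centre(2)[OF B] by simp
    ultimately have "z \<in> cylinder P (centre B) (\<beta> * ?r) 0" using z(2) by (simp add: cylinder_def)
    thus False using 1(3) z(1) by blast
  qed
  \<comment> \<open>An interval of length \<open>2 * ?r'\<close> now sits in one half, of length
    \<open>?r\<close>, of the old interval.\<close>
  hence "?x < ?x' - ?r' \<or> ?x' + ?r' < ?x" unfolding fst_ball[OF 1(1)] by auto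
  thus ?thesis using sub centre(2)[OF 1(1)] unfolding atLeastatMost_subset_iff by linarith
qed

section \<open>Finite plays as initial segments of a sequence of balls\<close>

lemma bob_play_map_iff:
  "bob_play P \<beta> \<sigma> (map B [0..<Suc n]) \<longleftrightarrow> B 0 \<in> closed_balls P \<and>
    (\<forall>j<n. bob_legal P \<beta> (B j) (\<sigma> (map B [0..<Suc j])) (B (Suc j)))"
proof -
  have "map B [0..<Suc n] ! j = B j" if "j \<le> n" for j
    using that by (subst nth_map) (auto simp del: upt_Suc)
  moreover have "take (Suc j) (map B [0..<Suc n]) = map B [0..<Suc j]" if "j < n" for j
    using that by (simp add: take_map del: upt_Suc)
  ultimately show ?thesis by (auto simp: bob_play_def simp del: upt_Suc)
qed

lemma bob_play_step:
  assumes "bob_play P \<beta> \<sigma> (map B [0..<Suc n])" "j < n"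
  shows "bob_legal P \<beta> (B j) (\<sigma> (map B [0..<Suc j])) (B (Suc j))"
    and "B (Suc j) \<in> closed_balls P" "B (Suc j) \<subseteq> B j"
    and "B (Suc j) \<inter> \<sigma> (map B [0..<Suc j]) = {}"
    and "\<beta> * ball_radius P (B j) \<le> ball_radius P (B (Suc j))"
proof -
  show *: "bob_legal P \<beta> (B j) (\<sigma> (map B [0..<Suc j])) (B (Suc j))"
    using assms unfolding bob_play_map_iff by (elim conjE allE impE)
  show "B (Suc j) \<in> closed_balls P" "B (Suc j) \<subseteq> B j"
    "B (Suc j) \<inter> \<sigma> (map B [0..<Suc j]) = {}"
    "\<beta> * ball_radius P (B j) \<le> ball_radius P (B (Suc j))"
    using * unfolding bob_legal_def by blast+
qed

lemma bob_play_balls: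
  assumes "bob_play P \<beta> \<sigma> (map B [0..<Suc n])" "j \<le> n"
  shows "B j \<in> closed_balls P"
proof (cases j)
  case 0
  show ?thesis using assms(1) unfolding 0 bob_play_map_iff by (rule conjunct1)
next
  case (Suc i)
  thus ?thesis using bob_play_step(2)[OF assms(1), of i] assms(2) by simp
qed

lemma bob_play_decreasing:
  assumes "bob_play P \<beta> \<sigma> (map B [0..<Suc n])" "k \<le> n" "j \<le> k"
  shows "B k \<subseteq> B j"
  using assms(3,2)
proof (induction k rule: dec_induct)
  case (step k)
  have "B (Suc k) \<subseteq> B k" using bob_play_step(3)[OF assms(1)] step.prems by simp
  thus ?case using step by simp
qed simp

lemma bob_play_radius_ge:
  assumes "bob_play P \<beta> \<sigma> (map B [0..<Suc n])" "0 < \<beta>" "j + i \<le> n"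
  shows "\<beta> ^ i * ball_radius P (B j) \<le> ball_radius P (B (j + i))"
  using assms(3)
proof (induction i)
  case (Suc i)
  have "\<beta> ^ Suc i * ball_radius P (B j) = \<beta> * (\<beta> ^ i * ball_radius P (B j))" by simp
  also have "\<dots> \<le> \<beta> * ball_radius P (B (j + i))" using Suc assms(2) by (intro mult_left_mono) auto
  also have "\<dots> \<le> ball_radius P (B (j + Suc i))"
    using bob_play_step(5)[OF assms(1), of "j + i"] Suc.prems by simp
  finally show ?case .
qed simp

text \<open>\<open>bob_can_move\<close> settles that Bob can always continue, which leaves Alice's
  legality and the outcome of infinite plays. A finite play \<open>Bs\<close> is treated as an
  initial segment of the sequence \<open>(!) Bs\<close>.\<close>

lemma winning_strategyI:
  assumes \<beta>: "0 < \<beta>" "\<beta> < 1 / 3" "\<And>p. p \<in> P \<Longrightarrow> \<beta> < 1 / real p"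
    and legal: "\<And>B n. bob_play P \<beta> \<sigma> (map B [0..<Suc n]) \<Longrightarrow> alice_legal P \<beta> (B n) (\<sigma> (map B [0..<Suc n]))"
    and win: "\<And>B. (\<And>n. bob_play P \<beta> \<sigma> (map B [0..<Suc n])) \<Longrightarrow> (\<Inter>j. B j) \<inter> F \<noteq> {}"
  shows "winning_strategy P \<beta> F \<sigma>"
  unfolding winning_strategy_def
proof (intro conjI allI impI)
  fix Bs assume *: "bob_play P \<beta> \<sigma> Bs"
  hence "Bs \<noteq> []" by (simp add: bob_play_def)
  then obtain n where n: "length Bs = Suc n" by (cases Bs) auto
  have Bs: "map ((!) Bs) [0..<Suc n] = Bs" unfolding n[symmetric] by (rule map_nth)
  have l: "last Bs = Bs ! n" using n by (simp add: last_conv_nth \<open>Bs \<noteq> []\<close>)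
  show A: "alice_legal P \<beta> (last Bs) (\<sigma> Bs)" using legal[of "(!) Bs" n] * Bs l by simp
  have "last Bs \<in> closed_balls P" using bob_play_balls[of \<beta> \<sigma> "(!) Bs" n n] * Bs l by simp
  from bob_can_move[OF \<beta> this A] show "\<exists>B'. bob_legal P \<beta> (last Bs) (\<sigma> Bs) B'" .
qed (use win in blast)

end

section \<open>Affine maps in coordinates\<close>

text \<open>In coordinate \<open>i\<close> all distances are multiplied by one factor
  \<open>s i\<close>, the absolute value of \<open>D\<close> there. The coordinates are finite in
  number and \<open>D\<close> is nonzero, so the least and the greatest factor are positive and
  serve as \<open>m\<close> and \<open>M\<close>.\<close>

lemma invertible_affine_hom_coord_dist:
  assumes P: "finite P" "P \<noteq> {}" "\<forall>p\<in>P. prime p" and \<Psi>: "invertible_affine_hom P \<Psi>"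
  obtains m M where "m > 0" "M > 0" "\<Psi> ` XP P = XP P"
    "\<And>i x z. i \<in> insert 0 P \<Longrightarrow> x \<in> XP P \<Longrightarrow> z \<in> XP P \<Longrightarrow>
      m * coord_dist i x z \<le> coord_dist i (\<Psi> x) (\<Psi> z) \<and> coord_dist i (\<Psi> x) (\<Psi> z) \<le> M * coord_dist i x z"
proof -
  interpret prime_set P by unfold_locales (use P in auto)
  obtain D a where D: "a \<in> XP P" "D \<noteq> 0" "\<And>x. x \<in> XP P \<Longrightarrow> \<Psi> x =
      (of_rat D * fst x + fst a,
       \<lambda>p\<in>P. padic_of_rat p D \<otimes>\<^bsub>padic_field p\<^esub> snd x p \<oplus>\<^bsub>padic_field p\<^esub> snd a p)"
    using \<Psi> unfolding invertible_affine_hom_def by blast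
  define s where "s i = (if i = 0 then \<bar>of_rat D\<bar> else padic_abs i D)" for i :: nat
  have s_pos: "s i > 0" if "i \<in> insert 0 P" for i
  proof (cases "i = 0")
    case False
    have "padic_abs i D \<noteq> 0" using padic_abs_eq_0_iff[OF prime_coord[OF that False], of D] D(2) by blast
    hence "padic_abs i D > 0" using padic_abs_nonneg[of i D] by linarith
    thus ?thesis using False by (simp add: s_def)
  qed (use D(2) in \<open>simp add: s_def\<close>)
  have cd: "coord_dist i (\<Psi> x) (\<Psi> z) = s i * coord_dist i x z"
    if i: "i \<in> insert 0 P" and x: "x \<in> XP P" and z: "z \<in> XP P" for i x z
  proof (cases "i = 0")
    case True
    have "\<bar>of_rat D * fst x - of_rat D * fst z\<bar> = \<bar>of_rat D\<bar> * \<bar>fst x - fst z\<bar>"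
      by (metis abs_mult right_diff_distrib)
    thus ?thesis using D(3)[OF x] D(3)[OF z] True by (simp add: coord_dist_def s_def)
  next
    case False
    hence i': "i \<in> P" using i by auto
    show ?thesis using D(3)[OF x] D(3)[OF z] False i'
        padic_affine_diff[OF prime_coord[OF i False] coord_carrier[OF x i'] coord_carrier[OF z i'] coord_carrier[OF D(1) i'], of D]
      by (simp add: coord_dist_def s_def)
  qed
  have "\<Psi> x \<in> XP P" if x: "x \<in> XP P" for x
  proof -
    have "padic_of_rat p D \<otimes>\<^bsub>padic_field p\<^esub> snd x p \<oplus>\<^bsub>padic_field p\<^esub> snd a p \<in> carrier (padic_field p)"
      if p: "p \<in> P" for p
    proof -
      have pp: "prime p" using p P(3) by blast
      interpret cring "padic_field p" by (rule cring_padic_field[OF pp])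
      show ?thesis using padic_of_rat_ring_hom(1)[OF pp] coord_carrier[OF x p] coord_carrier[OF D(1) p] by simp
    qed
    thus ?thesis unfolding D(3)[OF x] by (auto simp: XP_def)
  qed
  moreover have "y \<in> \<Psi> ` XP P" if y: "y \<in> XP P" for y
  proof -
    have "\<exists>u\<in>carrier (padic_field p).
        padic_of_rat p D \<otimes>\<^bsub>padic_field p\<^esub> u \<oplus>\<^bsub>padic_field p\<^esub> snd a p = snd y p" if p: "p \<in> P" for p
      by (rule padic_affine_surj) (use P(3) p coord_carrier[OF y p] coord_carrier[OF D(1) p] D(2) in auto)
    then obtain u where u: "\<And>p. p \<in> P \<Longrightarrow> u p \<in> carrier (padic_field p)"
      "\<And>p. p \<in> P \<Longrightarrow> padic_of_rat p D \<otimes>\<^bsub>padic_field p\<^esub> u p \<oplus>\<^bsub>padic_field p\<^esub> snd a p = snd y p"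
      by metis
    define x where "x = ((fst y - fst a) / of_rat D, restrict u P)"
    have x: "x \<in> XP P" using u(1) by (auto simp: x_def XP_def)
    have "snd y \<in> extensional P" using y by (auto simp: XP_def PiE_def)
    hence "(\<lambda>p\<in>P. padic_of_rat p D \<otimes>\<^bsub>padic_field p\<^esub> snd x p \<oplus>\<^bsub>padic_field p\<^esub> snd a p) = snd y"
      using u(2) by (intro extensionalityI[of _ P]) (auto simp: x_def)
    hence "\<Psi> x = y" using D(2) unfolding D(3)[OF x] by (simp add: x_def prod_eq_iff)
    thus ?thesis using x by blast
  qed
  ultimately have im: "\<Psi> ` XP P = XP P" by blast
  have fin: "finite (s ` insert 0 P)" "s ` insert 0 P \<noteq> {}" using P(1) by auto
  show thesis
  proof (rule that[OF _ _ im])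
    show "Min (s ` insert 0 P) > 0" using fin s_pos by (subst Min_gr_iff) auto
    show "Max (s ` insert 0 P) > 0" using fin s_pos by (subst Max_gr_iff) auto
    fix i x z assume i: "i \<in> insert 0 P" and x: "x \<in> XP P" and z: "z \<in> XP P"
    \<comment> \<open>Going from \<open>x\<close> to \<open>z\<close> and back bounds zero by twice
      the distance.\<close>
    have "coord_dist i x z \<ge> 0"
      using coord_dist_triangle[OF i x z x] coord_dist_commute[OF i x z] coord_dist_refl[OF i x] by simp
    moreover have "Min (s ` insert 0 P) \<le> s i" "s i \<le> Max (s ` insert 0 P)"
      using fin(1) i by (auto intro!: Min_le Max_ge)
    ultimately show "Min (s ` insert 0 P) * coord_dist i x z \<le> coord_dist i (\<Psi> x) (\<Psi> z) \<and>
        coord_dist i (\<Psi> x) (\<Psi> z) \<le> Max (s ` insert 0 P) * coord_dist i x z"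
      unfolding cd[OF i x z] by (intro conjI mult_right_mono)
  qed
qed

section \<open>Transfer of strategies\<close>

text \<open>Alice plays the real game with \<open>\<beta>\<close> and simulates a game on
  \<open>S\<close> with the smaller \<open>\<beta>\<^sub>0\<close>, where \<open>\<tau>\<close>
  wins. A simulated move takes \<open>Suc N\<close> real ones, so
  \<open>\<beta>\<^sub>0 \<le> \<beta> ^ Suc N\<close> makes it large enough to be legal. The
  inequality \<open>small\<close> makes it avoid the simulated cylinder.\<close>

locale pullback_game = prime_set +
  fixes \<Psi> :: "point \<Rightarrow> point" and m M \<beta> \<beta>\<^sub>0 :: real and N :: nat and S \<tau>
  assumes mM: "m > 0" "M > 0" and onto: "\<Psi> ` XP P = XP P"
    and coord_dist_bounds: "\<And>i x z. i \<in> insert 0 P \<Longrightarrow> x \<in> XP P \<Longrightarrow> z \<in> XP P \<Longrightarrow>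
      m * coord_dist i x z \<le> coord_dist i (\<Psi> x) (\<Psi> z) \<and> coord_dist i (\<Psi> x) (\<Psi> z) \<le> M * coord_dist i x z"
    and \<beta>: "0 < \<beta>" "\<beta> < 1 / 3" "\<And>p. p \<in> P \<Longrightarrow> \<beta> < 1 / real p"
    and \<beta>\<^sub>0: "\<beta>\<^sub>0 \<le> \<beta> ^ Suc N" "0 < \<beta>\<^sub>0"
    and small: "2 * M * ((1 / 2) ^ N + \<beta>\<^sub>0) < m * \<beta>" and N: "N > 0"
    and \<tau>: "winning_strategy P \<beta>\<^sub>0 S \<tau>"
begin

text \<open>The image of a ball need not be a ball, since the coordinates are stretched differently.
  Radius \<open>M * ball_radius P B\<close> would cover the image; the factor 2 leaves room for
  nesting the shadows.\<close>

definition shadow :: "point set \<Rightarrow> point set" where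
  "shadow B = closed_ball P (\<Psi> (centre B)) (2 * M * ball_radius P B)"

lemma \<Psi>_mem: "x \<in> XP P \<Longrightarrow> \<Psi> x \<in> XP P"
  using onto by blast

lemma shadow:
  assumes "B \<in> closed_balls P"
  shows "shadow B \<in> closed_balls P" "ball_radius P (shadow B) = 2 * M * ball_radius P B"
proof -
  have *: "2 * M * ball_radius P B > 0" using mM centre[OF assms] by simp
  show "shadow B \<in> closed_balls P"
    unfolding shadow_def closed_balls_def using * \<Psi>_mem[OF centre(1)[OF assms]] by blast
  show "ball_radius P (shadow B) = 2 * M * ball_radius P B"
    unfolding shadow_def by (rule ball_radius_closed_ball[OF P \<Psi>_mem[OF centre(1)[OF assms]] *])
qed

lemma mem_shadow:
  "B \<in> closed_balls P \<Longrightarrow> z \<in> shadow B \<longleftrightarrow>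
    z \<in> XP P \<and> (\<forall>i\<in>insert 0 P. coord_dist i (\<Psi> (centre B)) z \<le> 2 * M * ball_radius P B)"
  unfolding shadow_def by (rule mem_closed_ball[OF \<Psi>_mem[OF centre(1)]])

text \<open>\<open>C'\<close> has parameter \<open>\<beta> * ball_radius P B\<close>, the coordinate
  of \<open>C\<close> and a centre mapped to that of \<open>C\<close>. The centre of a ball avoiding
  \<open>C'\<close> is mapped far from the centre of \<open>C\<close>, while the shadow of that ball
  and \<open>C\<close> are both small by comparison.\<close>

lemma pullback_move:
  assumes B: "B \<in> closed_balls P" and C: "alice_legal P \<beta>\<^sub>0 (shadow B) C"
  shows "\<exists>C'. alice_legal P \<beta> B C' \<and> (\<forall>B'. B' \<in> closed_balls P \<and> B' \<subseteq> B \<and> B' \<inter> C' = {} \<and>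
    \<beta>\<^sub>0 * ball_radius P B \<le> ball_radius P B' \<and> ball_radius P B' \<le> (1 / 2) ^ N * ball_radius P B
    \<longrightarrow> bob_legal P \<beta>\<^sub>0 (shadow B) C (shadow B'))"
proof -
  let ?r = "ball_radius P B"
  obtain c i where c: "c \<in> XP P" "i \<in> insert 0 P"
    "\<And>z. z \<in> C \<Longrightarrow> z \<in> XP P \<and> coord_dist i c z \<le> \<beta>\<^sub>0 * (2 * M * ?r)"
    using alice_legalE[OF C] shadow(2)[OF B] by metis
  obtain c' where c': "c' \<in> XP P" "\<Psi> c' = c" using c(1) onto by (metis imageE)
  note r = centre(2)[OF B] and x = centre(1)[OF B]
  have "bob_legal P \<beta>\<^sub>0 (shadow B) C (shadow B')"
    if B': "B' \<in> closed_balls P" "B' \<subseteq> B" "B' \<inter> cylinder P c' (\<beta> * ?r) i = {}"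
      and ge: "\<beta>\<^sub>0 * ?r \<le> ball_radius P B'" and le: "ball_radius P B' \<le> (1 / 2) ^ N * ?r" for B'
  proof -
    let ?r' = "ball_radius P B'"
    note x' = centre(1)[OF B'(1)] and cm = centre_mem[OF B'(1)]
    \<comment> \<open>Since \<open>N > 0\<close>, the radius is at least halved. The image of the
      centre moves by at most \<open>M * ?r\<close>, and the radius of the new shadow uses the other
      half of \<open>2 * M * ?r\<close>.\<close>
    have "(1 / 2 :: real) ^ N \<le> 1 / 2" using power_decreasing[of 1 N "1 / 2 :: real"] N by simp
    hence "?r' \<le> 1 / 2 * ?r" using le r mult_right_mono[of "(1 / 2) ^ N" "1 / 2" ?r] by linarith
    hence half: "2 * M * ?r' \<le> M * ?r" using mM(2) mult_left_mono[of ?r' "1 / 2 * ?r" "2 * M"] by simp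
    have "shadow B' \<subseteq> shadow B"
    proof
      fix z assume "z \<in> shadow B'"
      hence z: "z \<in> XP P" "\<And>j. j \<in> insert 0 P \<Longrightarrow> coord_dist j (\<Psi> (centre B')) z \<le> 2 * M * ?r'"
        using mem_shadow[OF B'(1)] by auto
      have "coord_dist j (\<Psi> (centre B)) z \<le> 2 * M * ?r" if j: "j \<in> insert 0 P" for j
      proof -
        have "coord_dist j (centre B) (centre B') \<le> ?r" using cm B'(2) mem_ball[OF B] j by blast
        hence "M * coord_dist j (centre B) (centre B') \<le> M * ?r" using mM(2) by simp
        hence "coord_dist j (\<Psi> (centre B)) (\<Psi> (centre B')) \<le> M * ?r"
          using coord_dist_bounds[OF j x x'] by linarith
        thus ?thesis
          using coord_dist_triangle[OF j \<Psi>_mem[OF x] \<Psi>_mem[OF x'] z(1)] z(2)[OF j] half by linarith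
      qed
      thus "z \<in> shadow B" using mem_shadow[OF B] z(1) by blast
    qed
    moreover have "z \<notin> C" if z: "z \<in> shadow B'" for z
    proof
      assume zC: "z \<in> C"
      have zX: "z \<in> XP P" and zx': "coord_dist i (\<Psi> (centre B')) z \<le> 2 * M * ?r'"
        using z mem_shadow[OF B'(1)] c(2) by auto
      \<comment> \<open>Avoiding the cylinder bounds the stretched distance from below by
        \<open>m * \<beta> * ?r\<close>; a common point \<open>z\<close> bounds it from above by the
        reach of \<open>C\<close> plus the radius of the shadow.\<close>
      have "\<beta> * ?r \<le> coord_dist i c' (centre B')"
        using B'(3) cm mem_cylinder[OF c(2) c'(1), of "centre B'" "\<beta> * ?r"] x' by (meson disjoint_iff not_le)
      hence "m * (\<beta> * ?r) \<le> m * coord_dist i c' (centre B')" using mM(1) by simp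
      also have "\<dots> \<le> coord_dist i c (\<Psi> (centre B'))"
        using coord_dist_bounds[OF c(2) c'(1) x'] c'(2) by simp
      also have "\<dots> \<le> \<beta>\<^sub>0 * (2 * M * ?r) + 2 * M * ?r'"
        using coord_dist_triangle[OF c(2) c(1) zX \<Psi>_mem[OF x']] c(3)[OF zC] zx'
          coord_dist_commute[OF c(2) zX \<Psi>_mem[OF x']] by linarith
      also have "\<dots> \<le> \<beta>\<^sub>0 * (2 * M * ?r) + 2 * M * ((1 / 2) ^ N * ?r)"
        using le mM(2) by simp
      also have "\<dots> = 2 * M * ((1 / 2) ^ N + \<beta>\<^sub>0) * ?r" by (simp add: algebra_simps)
      also have "\<dots> < m * \<beta> * ?r" using small r by (rule mult_strict_right_mono)
      finally show False by simp
    qed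
    moreover have "\<beta>\<^sub>0 * (2 * M * ?r) \<le> 2 * M * ?r'"
      using mult_left_mono[OF ge, of "2 * M"] mM(2) by (simp add: mult_ac)
    ultimately show ?thesis unfolding bob_legal_def
      using shadow[OF B] shadow[OF B'(1)] by auto
  qed
  thus ?thesis using alice_legal_cylinder[OF B \<beta>(1) c'(1) c(2)] by blast
qed

definition answer :: "point set \<Rightarrow> point set \<Rightarrow> point set" where
  "answer B C = (SOME C'. alice_legal P \<beta> B C' \<and> (\<forall>B'. B' \<in> closed_balls P \<and> B' \<subseteq> B \<and> B' \<inter> C' = {} \<and>
    \<beta>\<^sub>0 * ball_radius P B \<le> ball_radius P B' \<and> ball_radius P B' \<le> (1 / 2) ^ N * ball_radius P B
    \<longrightarrow> bob_legal P \<beta>\<^sub>0 (shadow B) C (shadow B')))"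

lemma answer:
  assumes "B \<in> closed_balls P" "alice_legal P \<beta>\<^sub>0 (shadow B) C"
  shows "alice_legal P \<beta> B (answer B C)"
    and "B' \<in> closed_balls P \<Longrightarrow> B' \<subseteq> B \<Longrightarrow> B' \<inter> answer B C = {} \<Longrightarrow>
      \<beta>\<^sub>0 * ball_radius P B \<le> ball_radius P B' \<Longrightarrow> ball_radius P B' \<le> (1 / 2) ^ N * ball_radius P B \<Longrightarrow>
      bob_legal P \<beta>\<^sub>0 (shadow B) C (shadow B')"
  using someI_ex[OF pullback_move[OF assms]] unfolding answer_def[symmetric] by blast+

text \<open>\<open>n\<close> is the index of Bob's latest ball, so index \<open>0\<close> opens a
  round: one pulled-back answer followed by \<open>N\<close> halving cylinders.
  \<open>\<tau>\<close> sees only the shadows of the balls that open rounds.\<close>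

definition \<sigma> :: "point set list \<Rightarrow> point set" where
  "\<sigma> Bs = (let n = length Bs - 1; B = last Bs in
     if Suc N dvd n
     then answer B (\<tau> (map (\<lambda>j. shadow (Bs ! (j * Suc N))) [0..<Suc (n div Suc N)]))
     else cylinder P (centre B) (\<beta> * ball_radius P B) 0)"

lemma \<sigma>_round:
  "\<sigma> (map B [0..<Suc (k * Suc N)]) =
    answer (B (k * Suc N)) (\<tau> (map (\<lambda>j. shadow (B (j * Suc N))) [0..<Suc k]))"
proof -
  have "map B [0..<Suc (k * Suc N)] ! (j * Suc N) = B (j * Suc N)" if "j \<le> k" for j
  proof -
    have "j * Suc N < Suc (k * Suc N)" using that by (intro le_imp_less_Suc mult_le_mono1)
    thus ?thesis by (subst nth_map) (simp_all del: upt_Suc mult_Suc_right)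
  qed
  hence "map (\<lambda>j. shadow (map B [0..<Suc (k * Suc N)] ! (j * Suc N))) [0..<Suc k] =
      map (\<lambda>j. shadow (B (j * Suc N))) [0..<Suc k]"
    by (intro map_cong refl) (simp del: upt_Suc mult_Suc_right)
  moreover have "last (map B [0..<Suc (k * Suc N)]) = B (k * Suc N)" by simp
  moreover have "length (map B [0..<Suc (k * Suc N)]) - 1 = k * Suc N" by simp
  moreover have "k * Suc N div Suc N = k" by (rule nonzero_mult_div_cancel_right) simp
  ultimately show ?thesis unfolding \<sigma>_def Let_def by (simp only: dvd_triv_right if_True)
qed

lemma \<sigma>_halving:
  assumes "\<not> Suc N dvd n"
  shows "\<sigma> (map B [0..<Suc n]) = cylinder P (centre (B n)) (\<beta> * ball_radius P (B n)) 0"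
  using assms by (simp add: \<sigma>_def Let_def)

text \<open>The first move of a round guarantees no shrinking, each later one a factor of one half;
  hence exponent \<open>i\<close> after \<open>Suc i\<close> moves.\<close>

lemma round_radius:
  assumes B: "bob_play P \<beta> \<sigma> (map B [0..<Suc n])" and i: "k * Suc N + Suc i \<le> n" "i \<le> N"
  shows "ball_radius P (B (k * Suc N + Suc i)) \<le> (1 / 2) ^ i * ball_radius P (B (k * Suc N))"
  using i
proof (induction i)
  case 0
  have "ball_radius P (B (k * Suc N + Suc 0)) \<le> ball_radius P (B (k * Suc N))"
    by (intro ball_radius_mono bob_play_balls[OF B] bob_play_decreasing[OF B]) (use 0 in auto)
  thus ?case by simp
next
  case (Suc i)
  let ?n = "k * Suc N + Suc i"
  \<comment> \<open>Strictly inside a round Alice plays halving cylinders.\<close>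
  have "\<not> Suc N dvd Suc i" using Suc.prems(2) by (intro nat_dvd_not_less) auto
  hence "\<not> Suc N dvd ?n" using dvd_add_right_iff[of "Suc N" "k * Suc N" "Suc i"] dvd_triv_right by blast
  from bob_play_step(1)[OF B, of ?n, unfolded \<sigma>_halving[OF this]]
  have "bob_legal P \<beta> (B ?n) (cylinder P (centre (B ?n)) (\<beta> * ball_radius P (B ?n)) 0) (B (Suc ?n))"
    using Suc.prems(1) by simp
  moreover have "B ?n \<in> closed_balls P" using bob_play_balls[OF B, of ?n] Suc.prems(1) by simp
  ultimately have "ball_radius P (B (Suc ?n)) \<le> ball_radius P (B ?n) / 2"
    using halving_move[OF \<beta>(1)] by blast
  moreover have "ball_radius P (B ?n) \<le> (1 / 2) ^ i * ball_radius P (B (k * Suc N))"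
    using Suc by simp
  ultimately show ?case by simp
qed

text \<open>Induction on rounds: as long as the shadows form a legal play, \<open>\<tau>\<close>
  answers legally, and \<open>answer\<close> then turns the next complete round into one more legal
  move.\<close>

lemma shadow_play:
  assumes B: "bob_play P \<beta> \<sigma> (map B [0..<Suc n])" and k: "k * Suc N \<le> n"
  shows "bob_play P \<beta>\<^sub>0 \<tau> (map (\<lambda>j. shadow (B (j * Suc N))) [0..<Suc k])"
  using k
proof (induction k)
  case 0
  thus ?case using shadow(1)[OF bob_play_balls[OF B]] by (simp add: bob_play_map_iff del: upt_Suc)
next
  case (Suc k)
  let ?n = "k * Suc N" and ?Vs = "map (\<lambda>j. shadow (B (j * Suc N))) [0..<Suc k]"
  have n: "Suc k * Suc N = ?n + Suc N" by simp
  have lt: "?n + Suc N \<le> n" using Suc.prems n by simp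
  have IH: "bob_play P \<beta>\<^sub>0 \<tau> ?Vs" using Suc n by simp
  have lastV: "last ?Vs = shadow (B ?n)" by simp
  have legal: "alice_legal P \<beta>\<^sub>0 (shadow (B ?n)) (\<tau> ?Vs)"
    using \<tau> IH lastV unfolding winning_strategy_def by metis
  have balls: "B ?n \<in> closed_balls P" "B (?n + Suc N) \<in> closed_balls P"
    using bob_play_balls[OF B] lt by auto
  \<comment> \<open>Only the first ball of the round is required to avoid the answer; the last one
    inherits this by inclusion.\<close>
  have "B (Suc ?n) \<inter> answer (B ?n) (\<tau> ?Vs) = {}" "B (Suc ?n) \<subseteq> B ?n"
    using bob_play_step(3,4)[OF B, of ?n] lt unfolding \<sigma>_round by simp_all
  moreover have "B (?n + Suc N) \<subseteq> B (Suc ?n)"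
    by (rule bob_play_decreasing[OF B lt]) simp
  ultimately have avoid: "B (?n + Suc N) \<inter> answer (B ?n) (\<tau> ?Vs) = {}" "B (?n + Suc N) \<subseteq> B ?n"
    by blast+
  have "\<beta>\<^sub>0 * ball_radius P (B ?n) \<le> \<beta> ^ Suc N * ball_radius P (B ?n)"
    using \<beta>\<^sub>0(1) centre(2)[OF balls(1)] by (intro mult_right_mono) auto
  also have "\<dots> \<le> ball_radius P (B (?n + Suc N))" by (rule bob_play_radius_ge[OF B \<beta>(1) lt])
  finally have "bob_legal P \<beta>\<^sub>0 (shadow (B ?n)) (\<tau> ?Vs) (shadow (B (Suc k * Suc N)))"
    unfolding n by (intro answer(2)[OF balls(1) legal balls(2) avoid(2,1)] round_radius[OF B lt order_refl])
  thus ?case using IH unfolding bob_play_map_iff less_Suc_eq by blast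
qed

text \<open>A point \<open>s\<close> of \<open>S\<close> common to all shadows has a preimage
  \<open>y\<close>. As \<open>\<Psi>\<close> shrinks distances at most by the factor
  \<open>m\<close> and the shadows have radii tending to zero, the centres of Bob's balls converge
  to \<open>y\<close>.\<close>

lemma winning_pullback: "winning_strategy P \<beta> {x \<in> XP P. \<Psi> x \<in> S} \<sigma>"
proof (rule winning_strategyI[OF \<beta>])
  fix B n assume B: "bob_play P \<beta> \<sigma> (map B [0..<Suc n])"
  have ball: "B n \<in> closed_balls P" using bob_play_balls[OF B] by simp
  show "alice_legal P \<beta> (B n) (\<sigma> (map B [0..<Suc n]))"
  proof (cases "Suc N dvd n")
    case True
    then obtain k where k: "n = k * Suc N" by (metis dvd_def mult.commute)
    have "alice_legal P \<beta>\<^sub>0 (shadow (B n)) (\<tau> (map (\<lambda>j. shadow (B (j * Suc N))) [0..<Suc k]))"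
    proof -
      have "bob_play P \<beta>\<^sub>0 \<tau> (map (\<lambda>j. shadow (B (j * Suc N))) [0..<Suc k])"
        by (rule shadow_play[OF B]) (simp add: k)
      moreover have "last (map (\<lambda>j. shadow (B (j * Suc N))) [0..<Suc k]) = shadow (B n)"
        by (simp add: k)
      ultimately show ?thesis using \<tau> unfolding winning_strategy_def by metis
    qed
    from answer(1)[OF ball this] show ?thesis unfolding k by (simp only: \<sigma>_round)
  next
    case False
    show ?thesis unfolding \<sigma>_halving[OF False] by (rule alice_legal_cylinder[OF ball \<beta>(1) centre(1)[OF ball]]) simp
  qed
next
  fix B assume B: "\<And>n. bob_play P \<beta> \<sigma> (map B [0..<Suc n])"
  let ?r = "\<lambda>n. ball_radius P (B n)"
  have balls: "B n \<in> closed_balls P" for n using bob_play_balls[OF B] by blast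
  have "\<forall>n. bob_play P \<beta>\<^sub>0 \<tau> (map (\<lambda>j. shadow (B (j * Suc N))) [0..<Suc n])"
    using shadow_play[OF B order_refl] by blast
  hence "(\<Inter>k. shadow (B (k * Suc N))) \<inter> S \<noteq> {}"
    using \<tau> unfolding winning_strategy_def by blast
  then obtain s where s: "s \<in> S" "\<And>k. s \<in> shadow (B (k * Suc N))" by blast
  have "s \<in> XP P" using s(2) mem_shadow[OF balls] by blast
  then obtain y where y: "y \<in> XP P" "\<Psi> y = s" using onto by (metis imageE)
  \<comment> \<open>Each round contributes at least one halving because
    \<open>N > 0\<close>.\<close>
  have rad: "?r (k * Suc N) \<le> (1 / 2) ^ k * ?r 0" for k
  proof (induction k)
    case (Suc k)
    have "?r (Suc k * Suc N) = ?r (k * Suc N + Suc N)" by (simp only: mult_Suc add.commute)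
    also have "\<dots> \<le> (1 / 2) ^ N * ?r (k * Suc N)" by (rule round_radius[OF B order_refl order_refl])
    also have "\<dots> \<le> 1 / 2 * ?r (k * Suc N)"
      using power_decreasing[of 1 N "1 / 2 :: real"] N centre(2)[OF balls] by (intro mult_right_mono) (auto simp: less_imp_le)
    also have "\<dots> \<le> (1 / 2) ^ Suc k * ?r 0" using Suc by simp
    finally show ?case .
  qed simp
  have "y \<in> B j" for j
    unfolding mem_ball[OF balls]
  proof (intro conjI ballI y(1))
    fix i assume i: "i \<in> insert 0 P"
    \<comment> \<open>The distance from the centre of \<open>B j\<close> to \<open>y\<close> is
      estimated through the centre of a later ball; the error vanishes in the limit, and the closed
      ball admits the limiting bound.\<close>
    have "(\<lambda>k. ?r j + 2 * M / m * ((1 / 2) ^ k * ?r 0)) \<longlonglongrightarrow> ?r j + 2 * M / m * (0 * ?r 0)"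
      by (intro tendsto_intros LIMSEQ_power_zero) auto
    hence "(\<lambda>k. ?r j + 2 * M / m * ((1 / 2) ^ k * ?r 0)) \<longlonglongrightarrow> ?r j" by simp
    thus "coord_dist i (centre (B j)) y \<le> ?r j"
    proof (rule LIMSEQ_le_const)
      show "\<exists>K. \<forall>k\<ge>K. coord_dist i (centre (B j)) y \<le> ?r j + 2 * M / m * ((1 / 2) ^ k * ?r 0)"
      proof (intro exI allI impI)
        \<comment> \<open>Round \<open>k\<close> then opens no earlier than move \<open>j\<close>,
          so its centre lies in \<open>B j\<close>.\<close>
        fix k assume "j \<le> k"
        hence jk: "j \<le> k * Suc N" by (simp add: trans_le_add1)
        let ?c = "centre (B (k * Suc N))"
        have c: "?c \<in> XP P" by (rule centre[OF balls])
        have "?c \<in> B j" using centre_mem[OF balls] bob_play_decreasing[OF B order_refl jk] by blast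
        hence "coord_dist i (centre (B j)) ?c \<le> ?r j" using mem_ball[OF balls] i by blast
        moreover have "m * coord_dist i ?c y \<le> 2 * M * ((1 / 2) ^ k * ?r 0)"
        proof -
          have "m * coord_dist i ?c y \<le> coord_dist i (\<Psi> ?c) s"
            using coord_dist_bounds[OF i c y(1)] y(2) by simp
          also have "\<dots> \<le> 2 * M * ?r (k * Suc N)" using s(2) mem_shadow[OF balls] i by blast
          also have "\<dots> \<le> 2 * M * ((1 / 2) ^ k * ?r 0)" using rad mM(2) by (intro mult_left_mono) auto
          finally show ?thesis .
        qed
        hence "coord_dist i ?c y \<le> 2 * M / m * ((1 / 2) ^ k * ?r 0)"
          using mM(1) by (simp add: field_simps)
        ultimately show "coord_dist i (centre (B j)) y \<le> ?r j + 2 * M / m * ((1 / 2) ^ k * ?r 0)"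
          using coord_dist_triangle[OF i centre(1)[OF balls] c y(1)] by (smt (verit))
      qed
    qed
  qed
  thus "(\<Inter>j. B j) \<inter> {x \<in> XP P. \<Psi> x \<in> S} \<noteq> {}" using y s(1) by blast
qed

end

section \<open>Choice of the parameters and the winning dimension\<close>

text \<open>\<open>S\<close> may be known to be winning only for tiny parameters. The number of
  halvings and \<open>\<beta>\<^sub>0\<close> are fixed after \<open>\<beta>\<close>, so the bound
  on \<open>\<beta>\<close> comes only from Bob's ability to move.\<close>

lemma cylinder_absolute_winning_beta_pullback:
  assumes P: "finite P" "P \<noteq> {}" "\<forall>p\<in>P. prime p" and \<Psi>: "invertible_affine_hom P \<Psi>"
    and S: "CAW P S" and \<beta>: "0 < \<beta>" "\<beta> < 1 / 3" "\<And>p. p \<in> P \<Longrightarrow> \<beta> < 1 / real p"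
  shows "cylinder_absolute_winning_beta P \<beta> {x \<in> XP P. \<Psi> x \<in> S}"
proof -
  obtain \<beta>\<^sub>1 where \<beta>\<^sub>1: "0 < \<beta>\<^sub>1" "\<And>\<beta>. 0 < \<beta> \<Longrightarrow> \<beta> < \<beta>\<^sub>1 \<Longrightarrow> cylinder_absolute_winning_beta P \<beta> S"
    using S by (auto simp: CAW_def CAW_bounds_def)
  obtain m M where mM: "m > 0" "M > 0" "\<Psi> ` XP P = XP P"
    "\<And>i x z. i \<in> insert 0 P \<Longrightarrow> x \<in> XP P \<Longrightarrow> z \<in> XP P \<Longrightarrow>
      m * coord_dist i x z \<le> coord_dist i (\<Psi> x) (\<Psi> z) \<and> coord_dist i (\<Psi> x) (\<Psi> z) \<le> M * coord_dist i x z"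
    using invertible_affine_hom_coord_dist[OF P \<Psi>] by blast
  \<comment> \<open>Half of the budget in \<open>small\<close>: one share for the halvings, one for
    \<open>\<beta>\<^sub>0\<close>.\<close>
  define e where "e = m * \<beta> / (4 * M)"
  have e: "e > 0" using mM \<beta> by (simp add: e_def)
  obtain n where "(1 / 2 :: real) ^ n < e" using real_arch_pow_inv[OF e, of "1 / 2"] by auto
  \<comment> \<open>Passing to \<open>N = Suc n\<close> secures \<open>N > 0\<close>.\<close>
  moreover have "(1 / 2 :: real) ^ Suc n \<le> (1 / 2) ^ n" by simp
  ultimately have n: "(1 / 2 :: real) ^ Suc n < e" by linarith
  \<comment> \<open>Half of \<open>\<beta>\<^sub>1\<close> keeps the parameter strictly in the
    winning range of \<open>S\<close>; the exponent is \<open>Suc N\<close>, the length of a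
    round.\<close>
  define \<beta>\<^sub>0 where "\<beta>\<^sub>0 = min (\<beta>\<^sub>1 / 2) (min e (\<beta> ^ Suc (Suc n)))"
  have \<beta>\<^sub>0: "0 < \<beta>\<^sub>0" "\<beta>\<^sub>0 < \<beta>\<^sub>1" "\<beta>\<^sub>0 \<le> e" "\<beta>\<^sub>0 \<le> \<beta> ^ Suc (Suc n)"
    using \<beta>\<^sub>1(1) e \<beta>(1) by (auto simp: \<beta>\<^sub>0_def)
  then obtain \<tau> where \<tau>: "winning_strategy P \<beta>\<^sub>0 S \<tau>"
    using \<beta>\<^sub>1(2) unfolding cylinder_absolute_winning_beta_def by blast
  have "2 * M * ((1 / 2) ^ Suc n + \<beta>\<^sub>0) < 2 * M * (2 * e)"
    using n \<beta>\<^sub>0(3) mM(2) by (intro mult_strict_left_mono) auto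
  also have "\<dots> = m * \<beta>" using mM(2) by (simp add: e_def)
  finally have small: "2 * M * ((1 / 2) ^ Suc n + \<beta>\<^sub>0) < m * \<beta>" .
  interpret pullback_game P \<Psi> m M \<beta> \<beta>\<^sub>0 "Suc n" S \<tau>
    by unfold_locales (use P mM \<beta> \<beta>\<^sub>0 small \<tau> in auto)
  show ?thesis unfolding cylinder_absolute_winning_beta_def by (rule exI) (rule winning_pullback)
qed

lemma winning_strategy_mono:
  assumes \<sigma>: "winning_strategy P \<beta> F \<sigma>" and "F \<subseteq> G"
  shows "winning_strategy P \<beta> G \<sigma>"
  unfolding winning_strategy_def
proof (intro conjI[OF conjunct1[OF \<sigma>[unfolded winning_strategy_def]]] allI impI)
  fix B assume "\<forall>n. bob_play P \<beta> \<sigma> (map B [0..<Suc n])"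
  hence "(\<Inter>j. B j) \<inter> F \<noteq> {}"
    using conjunct2[OF \<sigma>[unfolded winning_strategy_def]] by metis
  thus "(\<Inter>j. B j) \<inter> G \<noteq> {}" using \<open>F \<subseteq> G\<close> by blast
qed

theorem theorem5p2:
  fixes P :: "nat set" and U S :: "point set" and \<Psi> :: "point \<Rightarrow> point"
  assumes "finite P" and "P \<noteq> {}" and "\<forall>p\<in>P. prime p"
    and "openin (XP_topology P) U"
    and "S \<subseteq> XP P" and "CAW P S"
    and "invertible_affine_hom P \<Psi>"
  shows "CAW P ({x \<in> XP P. \<Psi> x \<in> S} \<union> (XP P - U)) \<and>
    CAW_dim P ({x \<in> XP P. \<Psi> x \<in> S} \<union> (XP P - U)) \<ge> min (1 / 3) (1 / real (Max P))"
proof -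
  let ?T = "{x \<in> XP P. \<Psi> x \<in> S} \<union> (XP P - U)" and ?b = "min (1 / 3) (1 / real (Max P))"
  have Max: "Max P > 0" using assms(1-3) Max_in prime_gt_0_nat by blast
  have "cylinder_absolute_winning_beta P \<beta> ?T" if "0 < \<beta>" "\<beta> < ?b" for \<beta>
  proof -
    have "\<beta> < 1 / real p" if "p \<in> P" for p
    proof -
      have "0 < p" "p \<le> Max P" using that assms(1,3) prime_gt_0_nat by auto
      hence "1 / real (Max P) \<le> 1 / real p" by (simp add: frac_le)
      thus ?thesis using \<open>\<beta> < ?b\<close> by simp
    qed
    hence "cylinder_absolute_winning_beta P \<beta> {x \<in> XP P. \<Psi> x \<in> S}"
      using that by (intro cylinder_absolute_winning_beta_pullback assms) auto
    thus ?thesis unfolding cylinder_absolute_winning_beta_def using winning_strategy_mono by blast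
  qed
  \<comment> \<open>\<open>CAW_bounds\<close> asks for winning only strictly below the bound, so
    \<open>?b\<close> itself belongs to it and lies below the supremum.\<close>
  hence b: "?b \<in> CAW_bounds P ?T" using Max by (auto simp: CAW_bounds_def)
  moreover have "bdd_above (CAW_bounds P ?T)"
    unfolding CAW_bounds_def by (rule bdd_aboveI[of _ "1 / 3"]) blast
  ultimately show ?thesis unfolding CAW_def CAW_dim_def using cSup_upper by blast
qed

end
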